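(* Let $M$ be a type I manifold. Then $M$ is metrizable if and only if the end space $\mathcal F(M)\setminus M$ of $M$ is second countable and every end of $M$ is short.
   Context: A manifold is a connected Hausdorff space $M$ for which there is an integer $n\ge 1$ such that every point has an open neighborhood homeomorphic to $\mathbb R^n$; second countability is NOT assumed. A manifold $M$ is of type I if there is a sequence $\langle M_\alpha\mid\alpha<\omega_1\rangle$ of open Lindelöf subspaces of $M$ with $M=\bigcup_{\alpha<\omega_1}M_\alpha$ and $\mathrm{cl}_M(M_\alpha)\subseteq M_\beta$ whenever $\alpha<\beta<\omega_1$. Freudenthal compactification. Let $X$ be a locally compact Hausdorff space without isolated points. A subset of $X$ is bounded if it is contained in a compact subset of $X$, and unbounded otherwise; for $U$ open, $\partial(U)=\mathrm{cl}_X(U)\setminus U$. Let $\mathscr K(X)$ be the set of finite pairwise-disjoint collections $\mathscr U=\{U_0,\dots,U_n\}$ of open subsets of $X$, with a distinguished element $U_0$, such that $U_0$ is bounded, every $\partial(U_i)$ is compact, and $X=U_0\cup\bigcup_{i=1}^n\mathrm{cl}_X(U_i)$ with this union disjoint. Put $P_{\mathscr U}=\{\{x\}\mid x\in U_0\}\cup\{\mathrm{cl}_X(U_i)\mid 1\le i\le n\}$, a partition of $X$, and order $\mathscr K(X)$ by $\mathscr U\le\mathscr V$ iff $P_{\mathscr V}$ refines $P_{\mathscr U}$; this is a directed set. Let $X_{\mathscr U}$ be the quotient space of $X$ by $P_{\mathscr U}$ (compact Hausdorff), with the natural maps $X_{\mathscr V}\to X_{\mathscr U}$ for $\mathscr U\le\mathscr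 V$. The Freudenthal compactification $\mathcal F(X)$ is the inverse limit of this system; it is a compact Hausdorff space containing $X$ as a dense open subspace. The space of ends is $\mathcal E(X)=\mathcal F(X)\setminus X$; its points are the ends of $X$. An end of $X$ is short if it is a $G_\delta$ point of $\mathcal F(X)$. *)

theory Defs
  imports "HOL-Analysis.Analysis"
begin

section \<open>Manifolds\<close>

text \<open>No second countability (or metrizability) is built in.\<close>

definition topological_manifold :: "'a topology \<Rightarrow> bool" where
  "topological_manifold X \<longleftrightarrow>
     connected_space X \<and> Hausdorff_space X \<and>
     (\<exists>n\<ge>1. \<forall>x\<in>topspace X. \<exists>U. openin X U \<and> x \<in> U \<and>
        subtopology X U homeomorphic_space Euclidean_space n)"

text \<open>
  The ordinal \<open>\<omega>\<^sub>1\<close> is the well-order \<open>cardSuc natLeq\<close>: a cardinal order (so of least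
  possible order type) that is the cardinal successor of \<open>\<aleph>\<^sub>0\<close>. Its field is the index set
  \<open>{\<alpha>. \<alpha> < \<omega>\<^sub>1}\<close>. The relation is reflexive, hence the extra \<open>\<alpha> \<noteq> \<beta>\<close> below.
\<close>

abbreviation omega1 :: "nat set rel" where
  "omega1 \<equiv> cardSuc natLeq"

definition type_I :: "'a topology \<Rightarrow> bool" where
  "type_I X \<longleftrightarrow>
     (\<exists>W :: nat set \<Rightarrow> 'a set.
        (\<forall>\<alpha>\<in>Field omega1. openin X (W \<alpha>) \<and> Lindelof_space (subtopology X (W \<alpha>))) \<and>
        topspace X = (\<Union>\<alpha>\<in>Field omega1. W \<alpha>) \<and>
        (\<forall>\<alpha> \<beta>. (\<alpha>, \<beta>) \<in> omega1 \<and> \<alpha> \<noteq> \<beta> \<longrightarrow> X closure_of (W \<alpha>) \<subseteq> W \<beta>))"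


section \<open>Quotient spaces by partitions and inverse limits\<close>

definition quotient_topology :: "'a topology \<Rightarrow> 'a set set \<Rightarrow> 'a set topology" where
  "quotient_topology X P = topology (\<lambda>\<W>. \<W> \<subseteq> P \<and> openin X (\<Union>\<W>))"

definition block_of :: "'a set set \<Rightarrow> 'a \<Rightarrow> 'a set" where
  "block_of P x = (THE B. B \<in> P \<and> x \<in> B)"

lemma partition_on_eq:
  assumes "partition_on A P" "B \<in> P" "C \<in> P" "x \<in> B" "x \<in> C"
  shows "B = C"
  using disjointD[OF partition_onD2[OF assms(1)] assms(2,3)] assms(4,5) by blast

lemma block_of_unique:
  assumes "partition_on A P" "B \<in> P" "x \<in> B"
  shows "block_of P x = B"
  unfolding block_of_def
proof (rule the_equality)
  show "B \<in> P \<and> x \<in> B" using assms(2,3) by simp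
  show "C = B" if "C \<in> P \<and> x \<in> C" for C
    using that partition_on_eq[OF assms(1), of C B x] assms(2,3) by simp
qed

lemma block_of:
  assumes "partition_on A P" "x \<in> A"
  shows "block_of P x \<in> P" "x \<in> block_of P x"
proof -
  obtain B where "B \<in> P" "x \<in> B"
    using assms(2) partition_onD1[OF assms(1)] by blast
  then show "block_of P x \<in> P" "x \<in> block_of P x"
    using block_of_unique[OF assms(1)] by simp_all
qed

lemma istopology_quotient:
  assumes "partition_on (topspace X) P"
  shows "istopology (\<lambda>\<W>. \<W> \<subseteq> P \<and> openin X (\<Union>\<W>))"
  unfolding istopology_def
proof (intro conjI allI impI)
  fix S T assume *: "S \<subseteq> P \<and> openin X (\<Union>S)" "T \<subseteq> P \<and> openin X (\<Union>T)"
  have "\<Union>(S \<inter> T) = \<Union>S \<inter> \<Union>T"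
  proof (intro equalityI subsetI)
    fix x assume "x \<in> \<Union>S \<inter> \<Union>T"
    then obtain B C where "B \<in> S" "C \<in> T" "x \<in> B" "x \<in> C" by blast
    moreover from this have "B = C"
      using partition_on_eq[OF assms] * by blast
    ultimately show "x \<in> \<Union>(S \<inter> T)" by blast
  qed blast
  then show "openin X (\<Union>(S \<inter> T))"
    using * by (simp only: openin_Int)
  show "S \<inter> T \<subseteq> P"
    using * by blast
next
  fix \<K> assume *: "\<forall>K\<in>\<K>. K \<subseteq> P \<and> openin X (\<Union>K)"
  then show "\<Union>\<K> \<subseteq> P" by blast
  have "openin X (\<Union>K\<in>\<K>. \<Union>K)"
    using * by (intro openin_Union) auto
  moreover have "(\<Union>K\<in>\<K>. \<Union>K) = \<Union>(\<Union>\<K>)" by blast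
  ultimately show "openin X (\<Union>(\<Union>\<K>))" by simp
qed

lemma openin_quotient_topology:
  assumes "partition_on (topspace X) P"
  shows "openin (quotient_topology X P) \<W> \<longleftrightarrow> \<W> \<subseteq> P \<and> openin X (\<Union>\<W>)"
  unfolding quotient_topology_def topology_inverse'[OF istopology_quotient[OF assms]] ..

lemma topspace_quotient_topology:
  assumes "partition_on (topspace X) P"
  shows "topspace (quotient_topology X P) = P"
proof -
  have "openin X (\<Union>P)"
    using assms by (metis openin_topspace partition_on_def)
  then show ?thesis
    unfolding topspace_def openin_quotient_topology[OF assms] by blast
qed

lemma quotient_map_block_of:
  assumes "partition_on (topspace X) P"
  shows "quotient_map X (quotient_topology X P) (block_of P)"
  unfolding quotient_map_def topspace_quotient_topology[OF assms]
proof (intro conjI allI impI)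
  show "block_of P ` topspace X = P"
  proof
    show "block_of P ` topspace X \<subseteq> P"
      using block_of[OF assms] by auto
    show "P \<subseteq> block_of P ` topspace X"
    proof
      fix B assume B: "B \<in> P"
      then have "B \<noteq> {}" "B \<subseteq> topspace X"
        using assms unfolding partition_on_def by blast+
      then obtain x where "x \<in> B" "x \<in> topspace X" by blast
      then show "B \<in> block_of P ` topspace X"
        using block_of_unique[OF assms B] by blast
    qed
  qed
  fix U assume U: "U \<subseteq> P"
  have "{x \<in> topspace X. block_of P x \<in> U} = \<Union>U"
  proof (intro equalityI subsetI)
    fix x assume "x \<in> {x \<in> topspace X. block_of P x \<in> U}"
    then show "x \<in> \<Union>U" using block_of[OF assms] by blast
  next
    fix x assume "x \<in> \<Union>U"
    then obtain B where B: "B \<in> U" "x \<in> B" by blast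
    then have "block_of P x = B" "x \<in> topspace X"
      using U block_of_unique[OF assms] partition_onD1[OF assms] by blast+
    then show "x \<in> {x \<in> topspace X. block_of P x \<in> U}" using B by simp
  qed
  then show "openin X {x \<in> topspace X. block_of P x \<in> U} = openin (quotient_topology X P) U"
    using U by (simp add: openin_quotient_topology[OF assms])
qed

definition inverse_limit ::
  "'i set \<Rightarrow> ('i \<Rightarrow> 'i \<Rightarrow> bool) \<Rightarrow> ('i \<Rightarrow> 'b topology) \<Rightarrow> ('i \<Rightarrow> 'i \<Rightarrow> 'b \<Rightarrow> 'b) \<Rightarrow> ('i \<Rightarrow> 'b) topology"
  where
  "inverse_limit I le Y p =
     subtopology (product_topology Y I)
       {\<xi>. \<forall>i\<in>I. \<forall>j\<in>I. le i j \<longrightarrow> p i j (\<xi> j) = \<xi> i}"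


section \<open>The Freudenthal compactification\<close>

definition bounded_in :: "'a topology \<Rightarrow> 'a set \<Rightarrow> bool" where
  "bounded_in X S \<longleftrightarrow> (\<exists>K. compactin X K \<and> S \<subseteq> K)"

text \<open>
  A collection \<open>{U\<^sub>0, \<dots>, U\<^sub>n}\<close> with distinguished element \<open>U\<^sub>0\<close> is represented as the pair
  \<open>(U\<^sub>0, {U\<^sub>1, \<dots>, U\<^sub>n})\<close>. The members \<open>U\<^sub>1, \<dots>, U\<^sub>n\<close> are nonempty, as is implicit in the
  requirement that the closures be blocks of a partition; \<open>U\<^sub>0\<close> may be empty.
\<close>

type_synonym 'a pointed_family = "'a set \<times> 'a set set"

definition freudenthal_families :: "'a topology \<Rightarrow> 'a pointed_family set" where
  "freudenthal_families X =
     {(U0, \<U>). finite \<U> \<and> {} \<notin> \<U> \<and>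
        (\<forall>U\<in>insert U0 \<U>. openin X U) \<and>
        (\<forall>U\<in>\<U>. disjnt U0 U) \<and> pairwise disjnt \<U> \<and>
        bounded_in X U0 \<and>
        (\<forall>U\<in>insert U0 \<U>. compactin X (X closure_of U - U)) \<and>
        topspace X = U0 \<union> (\<Union>U\<in>\<U>. X closure_of U) \<and>
        (\<forall>U\<in>\<U>. disjnt U0 (X closure_of U)) \<and>
        pairwise (\<lambda>U V. disjnt (X closure_of U) (X closure_of V)) \<U>}"

definition freudenthal_partition :: "'a topology \<Rightarrow> 'a pointed_family \<Rightarrow> 'a set set" where
  "freudenthal_partition X = (\<lambda>(U0, \<U>). (\<lambda>x. {x}) ` U0 \<union> (\<lambda>U. X closure_of U) ` \<U>)"

lemma partition_on_freudenthal_partition: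
  assumes "\<UU> \<in> freudenthal_families X"
  shows "partition_on (topspace X) (freudenthal_partition X \<UU>)"
proof -
  obtain U0 \<U> where eq: "\<UU> = (U0, \<U>)" by (cases \<UU>)
  note A = assms[unfolded eq freudenthal_families_def mem_Collect_eq prod.case]
  have nonempty: "{} \<notin> \<U>" using A by (elim conjE)
  have op: "\<forall>U\<in>insert U0 \<U>. openin X U" using A by (elim conjE)
  have cover: "topspace X = U0 \<union> (\<Union>U\<in>\<U>. X closure_of U)" using A by (elim conjE)
  have d0: "\<forall>U\<in>\<U>. disjnt U0 (X closure_of U)" using A by (elim conjE)
  have d1: "pairwise (\<lambda>U V. disjnt (X closure_of U) (X closure_of V)) \<U>"
    using A by (elim conjE)
  have ne: "X closure_of U \<noteq> {}" if "U \<in> \<U>" for U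
  proof -
    have "U \<subseteq> X closure_of U" using op that by (simp add: closure_of_subset openin_subset)
    then show ?thesis using nonempty that by auto
  qed
  show ?thesis unfolding eq freudenthal_partition_def prod.case
  proof (rule partition_onI)
    show "\<Union> ((\<lambda>x. {x}) ` U0 \<union> (\<lambda>U. X closure_of U) ` \<U>) = topspace X"
      unfolding cover by simp
    show "{} \<notin> (\<lambda>x. {x}) ` U0 \<union> (\<lambda>U. X closure_of U) ` \<U>"
      using ne by fastforce
    fix p q assume "p \<in> (\<lambda>x. {x}) ` U0 \<union> (\<lambda>U. X closure_of U) ` \<U>"
      "q \<in> (\<lambda>x. {x}) ` U0 \<union> (\<lambda>U. X closure_of U) ` \<U>" "p \<noteq> q"
    then consider
        x y where "p = {x}" "q = {y}"
      | x V where "p = {x}" "x \<in> U0" "q = X closure_of V" "V \<in> \<U>"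
      | U y where "p = X closure_of U" "U \<in> \<U>" "q = {y}" "y \<in> U0"
      | U V where "p = X closure_of U" "U \<in> \<U>" "q = X closure_of V" "V \<in> \<U>"
      by blast
    then show "disjnt p q"
    proof cases
      case 1 then show ?thesis using \<open>p \<noteq> q\<close> by simp
    next
      case 2 then show ?thesis using d0 by (simp add: disjnt_iff)
    next
      case 3 then show ?thesis using d0 by (auto simp: disjnt_iff)
    next
      case 4 then show ?thesis using d1 \<open>p \<noteq> q\<close> by (metis pairwiseD)
    qed
  qed
qed

definition freudenthal_le :: "'a topology \<Rightarrow> 'a pointed_family \<Rightarrow> 'a pointed_family \<Rightarrow> bool" where
  "freudenthal_le X \<UU> \<VV> \<longleftrightarrow>
     refines (topspace X) (freudenthal_partition X \<VV>) (freudenthal_partition X \<UU>)"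

text \<open>The natural map from the quotient for \<open>\<VV>\<close> to the quotient for \<open>\<UU>\<close>, where \<open>\<UU> \<le> \<VV>\<close>,
  sends a block to the block containing it.\<close>

definition freudenthal_bond ::
  "'a topology \<Rightarrow> 'a pointed_family \<Rightarrow> 'a pointed_family \<Rightarrow> 'a set \<Rightarrow> 'a set" where
  "freudenthal_bond X \<UU> \<VV> B = (THE C. C \<in> freudenthal_partition X \<UU> \<and> B \<subseteq> C)"

lemma freudenthal_bond_unique:
  assumes "freudenthal_le X \<UU> \<VV>" "B \<in> freudenthal_partition X \<VV>"
    and "C \<in> freudenthal_partition X \<UU>" "B \<subseteq> C"
  shows "freudenthal_bond X \<UU> \<VV> B = C"
proof -
  have v: "partition_on (topspace X) (freudenthal_partition X \<VV>)"
    and u: "partition_on (topspace X) (freudenthal_partition X \<UU>)"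
    using assms(1) by (simp_all add: freudenthal_le_def refines_def)
  have "B \<noteq> {}" using partition_onD3[OF v] assms(2) by metis
  then obtain x where x: "x \<in> B" by (metis ex_in_conv)
  show ?thesis
    unfolding freudenthal_bond_def
  proof (rule the_equality)
    show "C \<in> freudenthal_partition X \<UU> \<and> B \<subseteq> C" using assms(3,4) by simp
    fix D assume "D \<in> freudenthal_partition X \<UU> \<and> B \<subseteq> D"
    then show "D = C"
      using partition_on_eq[OF u, of D C x] assms(3,4) x by auto
  qed
qed

definition freudenthal :: "'a topology \<Rightarrow> ('a pointed_family \<Rightarrow> 'a set) topology" where
  "freudenthal X =
     inverse_limit (freudenthal_families X) (freudenthal_le X)
       (\<lambda>\<UU>. quotient_topology X (freudenthal_partition X \<UU>))
       (freudenthal_bond X)"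

text \<open>The canonical copy of \<open>X\<close> inside its compactification.\<close>

definition freudenthal_embed :: "'a topology \<Rightarrow> 'a \<Rightarrow> ('a pointed_family \<Rightarrow> 'a set)" where
  "freudenthal_embed X x =
     (\<lambda>\<UU>\<in>freudenthal_families X. block_of (freudenthal_partition X \<UU>) x)"

lemma freudenthal_embed_in_topspace:
  assumes x: "x \<in> topspace X"
  shows "freudenthal_embed X x \<in> topspace (freudenthal X)"
proof -
  have bond: "freudenthal_bond X \<UU> \<VV> (block_of (freudenthal_partition X \<VV>) x)
          = block_of (freudenthal_partition X \<UU>) x"
    if "\<UU> \<in> freudenthal_families X" "\<VV> \<in> freudenthal_families X" "freudenthal_le X \<UU> \<VV>" for \<UU> \<VV>
  proof -
    note u = partition_on_freudenthal_partition[OF that(1)]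
    note v = partition_on_freudenthal_partition[OF that(2)]
    have "\<forall>B\<in>freudenthal_partition X \<VV>. \<exists>C\<in>freudenthal_partition X \<UU>. B \<subseteq> C"
      using that(3) by (simp add: freudenthal_le_def refines_def)
    then obtain C where C: "C \<in> freudenthal_partition X \<UU>"
      "block_of (freudenthal_partition X \<VV>) x \<subseteq> C"
      using block_of(1)[OF v x] by metis
    have "block_of (freudenthal_partition X \<UU>) x = C"
      using block_of_unique[OF u C(1)] subsetD[OF C(2) block_of(2)[OF v x]] by simp
    then show ?thesis
      using freudenthal_bond_unique[OF that(3) block_of(1)[OF v x] C] by simp
  qed
  have "block_of (freudenthal_partition X \<UU>) x
          \<in> topspace (quotient_topology X (freudenthal_partition X \<UU>))"
    if "\<UU> \<in> freudenthal_families X" for \<UU>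
    using block_of(1)[OF partition_on_freudenthal_partition[OF that] x]
    by (simp add: topspace_quotient_topology[OF partition_on_freudenthal_partition[OF that]])
  then show ?thesis
    by (simp add: freudenthal_def inverse_limit_def freudenthal_embed_def bond)
qed

definition ends :: "'a topology \<Rightarrow> ('a pointed_family \<Rightarrow> 'a set) set" where
  "ends X = topspace (freudenthal X) - freudenthal_embed X ` topspace X"

definition end_space :: "'a topology \<Rightarrow> ('a pointed_family \<Rightarrow> 'a set) topology" where
  "end_space X = subtopology (freudenthal X) (ends X)"

definition short_end :: "'a topology \<Rightarrow> ('a pointed_family \<Rightarrow> 'a set) \<Rightarrow> bool" where
  "short_end X e \<longleftrightarrow> e \<in> ends X \<and> gdelta_in (freudenthal X) {e}"

end

theory Submission
  imports Defs
begin

text \<open>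
  A type I manifold is metrizable iff it is contained in a single member of its exhaustion, that is,
  iff it is second countable.

  Suppose \<open>M\<close> is second countable. Modulo bounded sets, an open set with compact frontier is determined
  by a finite amount of information about a countable base, because \<open>M\<close> is connected; so the end space has a
  countable base. Since \<open>M\<close> is \<open>\<sigma>\<close>-compact, its ends form a \<open>G\<^sub>\<delta>\<close> set, and every end is short.

  Conversely, fix countably many open sets with compact frontiers whose traces form a base of the end
  space, and a member \<open>W\<close> of the exhaustion containing all these frontiers. A component \<open>C\<close> of the
  complement of the closure of \<open>W\<close> lies in or misses each of the chosen sets. If \<open>C\<close> were not contained in any
  member of the exhaustion, compactness of the Freudenthal compactification would give an end \<open>e\<close> at
  which \<open>C\<close> accumulates; then \<open>C\<close> lies, modulo a bounded set, in every neighbourhood of \<open>e\<close>, and since \<open>e\<close> is a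
  \<open>G\<^sub>\<delta>\<close> point, \<open>C\<close> is a countable union of bounded sets, a contradiction. There are only countably many
  such components, because each of them meets a fixed second countable open set.
\<close>

section \<open>Second countable spaces and components\<close>

text \<open>A set contained in a member of the exhaustion is called small in this comment. Since
  countable subsets of \<open>\<omega>\<^sub>1\<close> are bounded, small sets form a sigma-ideal,
  and it contains every bounded set; in this shape the length of the exhaustion enters both
  directions. The two conditions on the ends do different work: a countable base at the ends makes
  the union of all its frontiers small, while shortness controls what lies beyond them. The open
  long ray shows that the first alone is too weak: it has two ends, one of them not short. The
  obstacle is to pass from neighbourhoods in an inverse limit of quotients to subsets of
  \<open>M\<close>. Three facts bridge it: any two families have a common refinement whose core
  swallows a given compact set, the blocks of an end are therefore unbounded, and a closed set of
  the compactification that avoids the ends meets \<open>M\<close> in a bounded set.\<close>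

lemma second_countable_imp_metrizable_space:
  assumes "regular_space X" "Hausdorff_space X" "second_countable X"
  shows "metrizable_space X"
proof -
  have normal: "normal_space X"
    using assms regular_Lindelof_imp_normal_space second_countable_imp_Lindelof_space by blast
  obtain \<B> where \<B>: "countable \<B>" "\<And>V. V \<in> \<B> \<Longrightarrow> openin X V"
    and base: "\<And>U x. openin X U \<Longrightarrow> x \<in> U \<Longrightarrow> \<exists>V\<in>\<B>. x \<in> V \<and> V \<subseteq> U"
    using assms(3) unfolding second_countable_def by metis
  \<comment> \<open>Urysohn's pairs: each gets a function to the unit interval that is 0 on the
    closure of the first set and 1 off the second. There are countably many pairs, so the diagonal
    map lands in a metrizable cube.\<close>
  define P where "P \<equiv> {(A, B). A \<in> \<B> \<and> B \<in> \<B> \<and> X closure_of A \<subseteq> B}"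
  have countP: "countable P"
    by (rule countable_subset[of _ "\<B> \<times> \<B>"]) (auto simp: P_def \<B>(1))
  have "\<exists>f. continuous_map X (top_of_set {0..1::real}) f \<and> f ` (X closure_of fst p) \<subseteq> {0}
          \<and> f ` (topspace X - snd p) \<subseteq> {1}" if "p \<in> P" for p
  proof -
    have "closedin X (X closure_of fst p)" "closedin X (topspace X - snd p)"
      "disjnt (X closure_of fst p) (topspace X - snd p)"
      using that \<B>(2) by (auto simp: P_def disjnt_iff)
    then show ?thesis
      using Urysohn_lemma[OF normal, of _ _ 0 1] by (metis zero_le_one)
  qed
  then obtain f where f: "\<And>p. p \<in> P \<Longrightarrow> continuous_map X (top_of_set {0..1::real}) (f p)"
    and f0: "\<And>p. p \<in> P \<Longrightarrow> f p ` (X closure_of fst p) \<subseteq> {0}"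
    and f1: "\<And>p. p \<in> P \<Longrightarrow> f p ` (topspace X - snd p) \<subseteq> {1}"
    by metis
  \<comment> \<open>Regularity fits basic sets \<open>A\<close> and \<open>B\<close> between
    \<open>x\<close> and \<open>U\<close> with the closure of \<open>A\<close> inside
    \<open>B\<close>. The function of this pair makes the diagonal map injective and open onto its
    image.\<close>
  have sep: "\<exists>p\<in>P. f p x = 0 \<and> f p ` (topspace X - U) \<subseteq> {1}" if U: "openin X U" "x \<in> U" for x U
  proof -
    obtain B where B: "B \<in> \<B>" "x \<in> B" "B \<subseteq> U" using base[OF U] by blast
    have "neighbourhood_base_of (closedin X) X"
      using assms(1) neighbourhood_base_of_closedin by blast
    then obtain V D where V: "openin X V" "x \<in> V" "V \<subseteq> D" "closedin X D" "D \<subseteq> B"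
      using B \<B>(2)[OF B(1)] unfolding neighbourhood_base_of by meson
    then have cV: "X closure_of V \<subseteq> B" using closure_of_minimal[OF V(3,4)] by blast
    obtain A where A: "A \<in> \<B>" "x \<in> A" "A \<subseteq> V" using base[OF V(1,2)] by blast
    have "X closure_of A \<subseteq> B" using closure_of_mono[OF A(3)] cV by blast
    then have p: "(A, B) \<in> P" using A B by (simp add: P_def)
    have "x \<in> X closure_of A"
      using A \<B>(2) by (meson closure_of_subset openin_subset subsetD)
    then show ?thesis using f0[OF p] f1[OF p] B(3) by (intro bexI[OF _ p]) auto
  qed
  define e where "e \<equiv> \<lambda>x. \<lambda>p\<in>P. f p x"
  let ?C = "product_topology (\<lambda>p. top_of_set {0..1::real}) P"
  have conte: "continuous_map X ?C e"
    by (simp add: continuous_map_componentwise e_def f image_subset_iff)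
  have inj: "inj_on e (topspace X)"
  proof (rule inj_onI, rule ccontr)
    fix x y assume xy: "x \<in> topspace X" "y \<in> topspace X" "e x = e y" "x \<noteq> y"
    have "openin X (topspace X - {y})"
      using closedin_Hausdorff_singleton[OF assms(2) xy(2)] openin_diff[OF openin_topspace] by blast
    then obtain p where p: "p \<in> P" "f p x = 0" "f p ` (topspace X - (topspace X - {y})) \<subseteq> {1}"
      using sep[of "topspace X - {y}" x] xy by blast
    then have "f p y = 1" using xy by auto
    then show False using p xy(3) by (metis e_def restrict_apply' zero_neq_one)
  qed
  have op: "open_map X (subtopology ?C (e ` topspace X)) e"
    unfolding open_map_def
  proof (intro allI impI)
    fix U assume U: "openin X U"
    show "openin (subtopology ?C (e ` topspace X)) (e ` U)"
    proof (subst openin_subopen, intro ballI)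
      fix z assume "z \<in> e ` U"
      then obtain x where x: "x \<in> U" "z = e x" by blast
      obtain p where p: "p \<in> P" "f p x = 0" "f p ` (topspace X - U) \<subseteq> {1}"
        using sep[OF U x(1)] by blast
      define T where "T = {w \<in> topspace ?C. w p \<in> {0..<1}}"
      have "openin (top_of_set {0..1}) {0..<1::real}"
        using open_real_greaterThanLessThan[of "-1" 1] by (force simp: openin_open)
      then have T: "openin ?C T"
        unfolding T_def using p(1) by (intro openin_continuous_map_preimage[OF continuous_map_product_projection])
      have xt: "x \<in> topspace X" using U x openin_subset by blast
      show "\<exists>T. openin (subtopology ?C (e ` topspace X)) T \<and> z \<in> T \<and> T \<subseteq> e ` U"
      proof (intro exI conjI)
        show "openin (subtopology ?C (e ` topspace X)) (e ` topspace X \<inter> T)"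
          using T by (simp add: openin_subtopology_Int2)
        have "z \<in> topspace ?C" using continuous_map_image_subset_topspace[OF conte] xt x by blast
        then show "z \<in> e ` topspace X \<inter> T"
          using x p xt by (auto simp: T_def e_def)
        show "e ` topspace X \<inter> T \<subseteq> e ` U"
        proof
          fix w assume "w \<in> e ` topspace X \<inter> T"
          then obtain y where y: "y \<in> topspace X" "w = e y" "w p < 1" by (auto simp: T_def)
          then have "f p y < 1" using p by (simp add: e_def)
          then have "y \<in> U" using p y by force
          then show "w \<in> e ` U" using y by blast
        qed
      qed
    qed
  qed
  have cont: "continuous_map X (subtopology ?C (e ` topspace X)) e"
    using conte by (simp add: continuous_map_in_subtopology)
  have "e ` topspace X = topspace (subtopology ?C (e ` topspace X))"
    using continuous_map_image_subset_topspace[OF conte] by auto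
  then have "homeomorphic_map X (subtopology ?C (e ` topspace X)) e"
    by (rule bijective_open_imp_homeomorphic_map[OF cont op _ inj])
  then have "X homeomorphic_space subtopology ?C (e ` topspace X)"
    using homeomorphic_map_imp_homeomorphic_space by blast
  moreover have "metrizable_space ?C"
  proof -
    have "countable {p \<in> P. \<not> (\<exists>a. topspace (top_of_set {0..1::real}) \<subseteq> {a})}"
      by (rule countable_subset[OF _ countP]) blast
    then show ?thesis
      unfolding metrizable_space_product_topology
      using metrizable_space_euclidean metrizable_space_subtopology by blast
  qed
  ultimately show ?thesis
    using homeomorphic_metrizable_space metrizable_space_subtopology by blast
qed

lemma second_countable_euclidean: "second_countable (euclidean :: 'a::second_countable_topology topology)"
  unfolding second_countable_def
proof -
  obtain B :: "'a set set" where "countable B" "topological_basis B" using ex_countable_basis by blast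
  then show "\<exists>B. countable B \<and> (\<forall>V\<in>B. openin euclidean V) \<and>
      (\<forall>U x. openin euclidean U \<and> (x::'a) \<in> U \<longrightarrow> (\<exists>V\<in>B. x \<in> V \<and> V \<subseteq> U))"
    by (metis topological_basisE topological_basis_open open_openin)
qed

lemma second_countable_Euclidean_space: "second_countable (Euclidean_space n)"
  unfolding Euclidean_space_def
proof (rule second_countable_subtopology)
  have "second_countable (euclidean :: (nat \<Rightarrow> real) topology)"
    by (rule second_countable_euclidean)
  then show "second_countable (powertop_real (UNIV :: nat set))"
    by (simp add: euclidean_product_topology)
qed

lemma second_countable_subtopology_Union:
  assumes "countable \<U>" "\<And>U. U \<in> \<U> \<Longrightarrow> openin X U"
    and sc: "\<And>U. U \<in> \<U> \<Longrightarrow> second_countable (subtopology X U)"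
  shows "second_countable (subtopology X (\<Union>\<U>))"
proof -
  have "\<exists>\<B>. countable \<B> \<and> (\<forall>V\<in>\<B>. openin X V \<and> V \<subseteq> U) \<and>
      (\<forall>T x. openin X T \<and> x \<in> T \<and> T \<subseteq> U \<longrightarrow> (\<exists>V\<in>\<B>. x \<in> V \<and> V \<subseteq> T))" if "U \<in> \<U>" for U
    using sc[OF that] unfolding second_countable_def openin_open_subtopology[OF assms(2)[OF that]]
    by metis
  then obtain \<B> where \<B>: "\<And>U. U \<in> \<U> \<Longrightarrow> countable (\<B> U)"
    "\<And>U V. U \<in> \<U> \<Longrightarrow> V \<in> \<B> U \<Longrightarrow> openin X V \<and> V \<subseteq> U"
    and base: "\<And>U T x. U \<in> \<U> \<Longrightarrow> openin X T \<Longrightarrow> x \<in> T \<Longrightarrow> T \<subseteq> U \<Longrightarrow> \<exists>V\<in>\<B> U. x \<in> V \<and> V \<subseteq> T"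
    by metis
  have op: "openin X (\<Union>\<U>)" using assms(2) by blast
  show ?thesis
    unfolding second_countable_def openin_open_subtopology[OF op]
  proof (intro exI[of _ "\<Union>(\<B> ` \<U>)"] conjI allI impI ballI)
    show "countable (\<Union>(\<B> ` \<U>))" using assms(1) \<B>(1) by blast
    fix T x assume T: "(openin X T \<and> T \<subseteq> \<Union>\<U>) \<and> x \<in> T"
    then obtain U where "U \<in> \<U>" "x \<in> U" by blast
    then show "\<exists>V\<in>\<Union>(\<B> ` \<U>). x \<in> V \<and> V \<subseteq> T"
      using base[of U "T \<inter> U" x] T assms(2)[of U] by (meson IntI UN_I inf_le1 inf_le2 openin_Int order_trans)
  qed (use \<B> in blast)+
qed

text \<open>The countable chain condition: a basic set chosen inside each member determines that
  member by disjointness.\<close>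

lemma second_countable_imp_countable_disjoint:
  assumes "second_countable X" "pairwise disjnt \<C>"
    and C: "\<And>C. C \<in> \<C> \<Longrightarrow> openin X C" "{} \<notin> \<C>"
  shows "countable \<C>"
proof -
  obtain \<B> where \<B>: "countable \<B>"
    and base: "\<And>U x. openin X U \<Longrightarrow> x \<in> U \<Longrightarrow> \<exists>V\<in>\<B>. x \<in> V \<and> V \<subseteq> U"
    using assms(1) unfolding second_countable_def by metis
  have "\<exists>V\<in>\<B>. V \<noteq> {} \<and> V \<subseteq> C" if "C \<in> \<C>" for C
    using base C that by (metis equals0D equals0I)
  then obtain g where g: "\<And>C. C \<in> \<C> \<Longrightarrow> g C \<in> \<B> \<and> g C \<noteq> {} \<and> g C \<subseteq> C" by metis
  have "inj_on g \<C>"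
  proof (rule inj_onI, rule ccontr)
    fix C D assume "C \<in> \<C>" "D \<in> \<C>" "g C = g D" "C \<noteq> D"
    moreover from this have "C \<inter> D = {}" using assms(2) by (simp add: pairwise_def disjnt_def)
    ultimately show False using g[of C] g[of D] by blast
  qed
  moreover have "g ` \<C> \<subseteq> \<B>" using g by blast
  ultimately show ?thesis
    using \<B> countable_subset countable_image_inj_on by metis
qed

text \<open>A component of the complement that misses a neighbourhood of the closed set \<open>S\<close> would be clopen.\<close>

lemma connected_components_of_complement_meet:
  assumes "connected_space X" "locally_connected_space X" "closedin X S" "openin X W" "S \<subseteq> W" "S \<noteq> {}"
    and C: "C \<in> connected_components_of (subtopology X (topspace X - S))"
  shows "C \<inter> W \<noteq> {}"
proof
  assume CW: "C \<inter> W = {}"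
  have opS: "openin X (topspace X - S)" using assms(3) by blast
  have "openin X C"
    using assms(2) C opS locally_connected_space_open_connected_components by blast
  moreover have sub: "C \<subseteq> topspace X - S"
    using connected_components_of_subset[OF C] by auto
  \<comment> \<open>Being disjoint from the open set \<open>W\<close>, \<open>C\<close> has its
    closure off \<open>S\<close>, hence inside the subspace in which it is already closed.\<close>
  have "X closure_of C \<subseteq> topspace X - W"
    using CW assms(4) sub by (intro closure_of_minimal) auto
  then have "X closure_of C \<subseteq> topspace X - S" using assms(5) by blast
  moreover have "closedin (subtopology X (topspace X - S)) C"
    using C closedin_connected_components_of by blast
  ultimately have "X closure_of C = C"
    using sub by (metis closedin_closure_of closedin_subset closure_of_subset closure_of_subtopology_subset
        closure_of_eq closure_of_subtopology inf.absorb_iff2 openin_subset subset_antisym Int_absorb1)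
  then have "closedin X C" by (metis closedin_closure_of)
  then have "C = {} \<or> C = topspace X"
    using assms(1) \<open>openin X C\<close> connected_space_clopen_in by blast
  then show False
    using nonempty_connected_components_of[OF C] sub assms(3,6) closedin_subset by fastforce
qed

section \<open>Manifolds of type I\<close>

text \<open>Charts enter the argument through three local properties: this one, local compactness
  and local connectedness.\<close>

definition locally_second_countable :: "'a topology \<Rightarrow> bool" where
  "locally_second_countable X \<longleftrightarrow>
     (\<forall>x\<in>topspace X. \<exists>U. openin X U \<and> x \<in> U \<and> second_countable (subtopology X U))"

lemma topological_manifold_chart:
  assumes "topological_manifold X" "x \<in> topspace X"
  obtains n U where "openin X U" "x \<in> U" "subtopology X U homeomorphic_space Euclidean_space n"
proof -
  obtain n where "\<forall>x\<in>topspace X. \<exists>U. openin X U \<and> x \<in> U \<and> subtopology X U homeomorphic_space Euclidean_space n"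
    using assms(1) unfolding topological_manifold_def by (elim conjE exE)
  then show thesis using that assms(2) by blast
qed

lemma topological_manifold_imp_locally_second_countable:
  assumes "topological_manifold X"
  shows "locally_second_countable X"
  unfolding locally_second_countable_def
proof
  fix x assume "x \<in> topspace X"
  then obtain n U where U: "openin X U" "x \<in> U" "subtopology X U homeomorphic_space Euclidean_space n"
    using topological_manifold_chart[OF assms] by metis
  then have "second_countable (subtopology X U)"
    using homeomorphic_space_second_countability[OF U(3)] second_countable_Euclidean_space by blast
  then show "\<exists>U. openin X U \<and> x \<in> U \<and> second_countable (subtopology X U)" using U by blast
qed

lemma topological_manifold_imp_locally_compact_space:
  assumes "topological_manifold X"
  shows "locally_compact_space X"
  unfolding locally_compact_space_def
proof
  fix x assume "x \<in> topspace X"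
  then obtain n U where U: "openin X U" "x \<in> U" "subtopology X U homeomorphic_space Euclidean_space n"
    using topological_manifold_chart[OF assms] by metis
  have "locally_compact_space (subtopology X U)"
    using U(3) homeomorphic_locally_compact_space locally_compact_Euclidean_space by blast
  then have "\<exists>V K. (openin X V \<and> V \<subseteq> U) \<and> (compactin X K \<and> K \<subseteq> U) \<and> x \<in> V \<and> V \<subseteq> K"
    unfolding locally_compact_space_def openin_open_subtopology[OF U(1)] compactin_subtopology
    using U \<open>x \<in> topspace X\<close> by auto
  then show "\<exists>V K. openin X V \<and> compactin X K \<and> x \<in> V \<and> V \<subseteq> K" by blast
qed

lemma topological_manifold_imp_locally_connected_space:
  assumes "topological_manifold X"
  shows "locally_connected_space X"
  unfolding locally_connected_space
proof (intro allI impI, elim conjE)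
  fix V x assume V: "openin X V" "x \<in> V"
  then obtain n U where U: "openin X U" "x \<in> U" "subtopology X U homeomorphic_space Euclidean_space n"
    using topological_manifold_chart[OF assms] openin_subset by (metis subsetD)
  have "locally_connected_space (subtopology X U)"
    using U(3) homeomorphic_locally_connected_space locally_connected_Euclidean_space by blast
  moreover have "openin (subtopology X U) (V \<inter> U)" "x \<in> V \<inter> U"
    using U V by (auto simp: openin_open_subtopology)
  ultimately obtain W where "openin (subtopology X U) W" "connectedin (subtopology X U) W" "x \<in> W" "W \<subseteq> V \<inter> U"
    unfolding locally_connected_space by metis
  then show "\<exists>W. openin X W \<and> connectedin X W \<and> x \<in> W \<and> W \<subseteq> V"
    using U(1) by (metis connectedin_subtopology le_inf_iff openin_open_subtopology)
qed

text \<open>The Lindelof property selects countably many second countable open sets that cover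
  \<open>S\<close>; their union is second countable, and so is its subspace
  \<open>S\<close>.\<close>

lemma Lindelof_imp_second_countable:
  assumes "locally_second_countable X" "S \<subseteq> topspace X" "Lindelof_space (subtopology X S)"
  shows "second_countable (subtopology X S)"
proof -
  define \<U> where "\<U> = {U. openin X U \<and> second_countable (subtopology X U)}"
  have "S \<subseteq> \<Union>\<U>"
    using assms(1,2) unfolding locally_second_countable_def \<U>_def by blast
  then obtain \<V> where "countable \<V>" "\<V> \<subseteq> \<U>" "S \<subseteq> \<Union>\<V>"
    using assms(3)[unfolded Lindelof_space_subtopology_subset[OF assms(2)], rule_format, of \<U>]
    by (auto simp: \<U>_def)
  moreover from this have "second_countable (subtopology X (\<Union>\<V>))"
    by (intro second_countable_subtopology_Union) (auto simp: \<U>_def)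
  ultimately show ?thesis
    by (metis inf.absorb_iff2 second_countable_subtopology subtopology_subtopology)
qed

text \<open>The only features of an \<open>\<omega>\<^sub>1\<close>-sequence witnessing type I that matter are kept here; the
  condition on the empty \<open>\<C>\<close> makes \<open>\<W>\<close> nonempty.\<close>

definition Lindelof_exhaustion :: "'a topology \<Rightarrow> 'a set set \<Rightarrow> bool" where
  "Lindelof_exhaustion X \<W> \<longleftrightarrow>
     (\<forall>W\<in>\<W>. openin X W \<and> Lindelof_space (subtopology X W)) \<and> topspace X = \<Union>\<W> \<and>
     (\<forall>\<C>. countable \<C> \<and> \<C> \<subseteq> \<W> \<longrightarrow> (\<exists>W\<in>\<W>. \<forall>C\<in>\<C>. X closure_of C \<subseteq> W))"

text \<open>Regularity of \<open>omega1\<close> as a successor cardinal. The bound must be strict,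
  since \<open>type_I\<close> compares closures only at distinct indices.\<close>

lemma countable_bounded_omega1:
  includes cardinal_syntax
  assumes "countable A" "A \<subseteq> Field omega1"
  obtains \<gamma> where "\<gamma> \<in> Field omega1" "\<And>\<alpha>. \<alpha> \<in> A \<Longrightarrow> (\<alpha>, \<gamma>) \<in> omega1 \<and> \<alpha> \<noteq> \<gamma>"
proof -
  have co: "Card_order omega1" using cardSuc_Card_order natLeq_Card_order by blast
  have inf: "infinite (Field omega1)"
    using natLeq_Cinfinite cinfinite_def Cinfinite_cardSuc by blast
  have wo: "Well_order omega1" using co card_order_on_well_order_on by blast
  then have tr: "trans omega1" and an: "antisym omega1"
    by (auto simp: well_order_on_def linear_order_on_def partial_order_on_def preorder_on_def)
  have rf: "refl_on (Field omega1) omega1"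
    using wo by (auto simp: well_order_on_def linear_order_on_def partial_order_on_def preorder_on_def)
  \<comment> \<open>Initial segments form an increasing chain covering \<open>A\<close>;
    \<open>cardSuc_UNION\<close> puts the countable set \<open>A\<close> into a single one of
    them.\<close>
  have "relChain omega1 (\<lambda>i. {j. (j, i) \<in> omega1})"
    unfolding relChain_def using tr by (auto elim: transE)
  moreover have "A \<subseteq> (\<Union>i\<in>Field omega1. {j. (j, i) \<in> omega1})"
    using assms(2) rf by (auto simp: refl_on_def)
  moreover have "|A| \<le>o natLeq"
    using assms(1) card_of_ordLeq[of A "UNIV :: nat set"] ordLeq_ordIso_trans[OF _ card_of_nat]
    unfolding countable_def by blast
  ultimately obtain i where i: "i \<in> Field omega1" "A \<subseteq> {j. (j, i) \<in> omega1}"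
    using cardSuc_UNION[OF natLeq_Card_order] natLeq_Cinfinite unfolding cinfinite_def by blast
  \<comment> \<open>An infinite cardinal order has no last element, which turns the bound
    \<open>i\<close> into a strict one.\<close>
  obtain \<gamma> where g: "\<gamma> \<in> Field omega1" "i \<noteq> \<gamma>" "(i, \<gamma>) \<in> omega1"
    using infinite_Card_order_limit[OF co inf i(1)] by blast
  show ?thesis
  proof (rule that[OF g(1)])
    fix \<alpha> assume "\<alpha> \<in> A"
    then have a: "(\<alpha>, i) \<in> omega1" using i by blast
    then have "(\<alpha>, \<gamma>) \<in> omega1" using g tr by (meson transD)
    moreover have "\<alpha> \<noteq> \<gamma>" using a g an by (auto dest: antisymD)
    ultimately show "(\<alpha>, \<gamma>) \<in> omega1 \<and> \<alpha> \<noteq> \<gamma>" by blast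
  qed
qed

lemma type_I_Lindelof_exhaustion:
  assumes "type_I X"
  obtains \<W> where "Lindelof_exhaustion X \<W>"
proof -
  obtain W where W: "\<And>\<alpha>. \<alpha> \<in> Field omega1 \<Longrightarrow> openin X (W \<alpha>) \<and> Lindelof_space (subtopology X (W \<alpha>))"
    "topspace X = (\<Union>\<alpha>\<in>Field omega1. W \<alpha>)"
    and mono: "\<And>\<alpha> \<beta>. (\<alpha>, \<beta>) \<in> omega1 \<Longrightarrow> \<alpha> \<noteq> \<beta> \<Longrightarrow> X closure_of (W \<alpha>) \<subseteq> W \<beta>"
    using assms unfolding type_I_def by metis
  show ?thesis
  proof (rule that[of "W ` Field omega1"], unfold Lindelof_exhaustion_def, intro conjI ballI allI impI)
    fix \<C> assume "countable \<C> \<and> \<C> \<subseteq> W ` Field omega1"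
    then obtain A where A: "countable A" "A \<subseteq> Field omega1" "\<C> = W ` A"
      by (metis countable_subset_image)
    obtain \<gamma> where "\<gamma> \<in> Field omega1" "\<And>\<alpha>. \<alpha> \<in> A \<Longrightarrow> (\<alpha>, \<gamma>) \<in> omega1 \<and> \<alpha> \<noteq> \<gamma>"
      using countable_bounded_omega1[OF A(1,2)] by metis
    then show "\<exists>V\<in>W ` Field omega1. \<forall>C\<in>\<C>. X closure_of C \<subseteq> V"
      using mono A(3) by blast
  qed (use W in auto)
qed

text \<open>The sigma-ideal property: the countably many members chosen for the sets
  \<open>S i\<close> have a common upper member.\<close>

lemma Lindelof_exhaustion_countable_Union:
  assumes "Lindelof_exhaustion X \<W>" "countable I" "\<And>i. i \<in> I \<Longrightarrow> \<exists>W\<in>\<W>. S i \<subseteq> W"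
  shows "\<exists>W\<in>\<W>. (\<Union>i\<in>I. S i) \<subseteq> W"
proof -
  obtain V where V: "\<And>i. i \<in> I \<Longrightarrow> V i \<in> \<W> \<and> S i \<subseteq> V i" using assms(3) by metis
  then obtain W where W: "W \<in> \<W>" "\<And>C. C \<in> V ` I \<Longrightarrow> X closure_of C \<subseteq> W"
    using assms(1,2) unfolding Lindelof_exhaustion_def
    by (metis (no_types, lifting) countable_image image_subsetI)
  have "V i \<subseteq> X closure_of V i" if "i \<in> I" for i
    using V[OF that] assms(1) unfolding Lindelof_exhaustion_def by (meson closure_of_subset openin_subset)
  moreover have "X closure_of V i \<subseteq> W" if "i \<in> I" for i using W(2) that by blast
  ultimately have "S i \<subseteq> W" if "i \<in> I" for i using V[OF that] that by (meson order_trans)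
  then show ?thesis using W(1) by blast
qed

text \<open>Finitely many members cover a compact set, and they lie in a common one.\<close>

lemma Lindelof_exhaustion_bounded_in:
  assumes "Lindelof_exhaustion X \<W>" "bounded_in X S"
  shows "\<exists>W\<in>\<W>. S \<subseteq> W"
proof -
  obtain K where K: "compactin X K" "S \<subseteq> K" using assms(2) unfolding bounded_in_def by blast
  have "K \<subseteq> \<Union>\<W>" "\<forall>W\<in>\<W>. openin X W"
    using assms(1) compactin_subset_topspace[OF K(1)] unfolding Lindelof_exhaustion_def by auto
  then obtain \<F> where "finite \<F>" "\<F> \<subseteq> \<W>" "K \<subseteq> \<Union>\<F>"
    using K(1) unfolding compactin_def by meson
  moreover have "\<exists>W\<in>\<W>. F \<subseteq> W" if "F \<in> \<F>" for F
    using that \<open>\<F> \<subseteq> \<W>\<close> by blast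
  ultimately have "\<exists>W\<in>\<W>. (\<Union>i\<in>\<F>. i) \<subseteq> W"
    using Lindelof_exhaustion_countable_Union[OF assms(1) countable_finite, of \<F> "\<lambda>i. i"] by blast
  then obtain W where "W \<in> \<W>" "\<Union>\<F> \<subseteq> W" by auto
  then show ?thesis using K \<open>K \<subseteq> \<Union>\<F>\<close> by (meson order_trans)
qed

section \<open>Refining Freudenthal families\<close>

lemma freudenthal_familiesD:
  assumes "(U0, \<U>) \<in> freudenthal_families X"
  shows "finite \<U>" "{} \<notin> \<U>" "openin X U0" "\<And>U. U \<in> \<U> \<Longrightarrow> openin X U"
    "\<And>U V. U \<in> \<U> \<Longrightarrow> V \<in> \<U> \<Longrightarrow> U \<noteq> V \<Longrightarrow> U \<inter> V = {}"
    "bounded_in X U0" "compactin X (X closure_of U0 - U0)"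
    "\<And>U. U \<in> \<U> \<Longrightarrow> compactin X (X closure_of U - U)"
    "topspace X = U0 \<union> (\<Union>U\<in>\<U>. X closure_of U)"
    "\<And>U. U \<in> \<U> \<Longrightarrow> U0 \<inter> X closure_of U = {}"
    "\<And>U V. U \<in> \<U> \<Longrightarrow> V \<in> \<U> \<Longrightarrow> U \<noteq> V \<Longrightarrow> X closure_of U \<inter> X closure_of V = {}"
proof -
  note A = assms[unfolded freudenthal_families_def mem_Collect_eq prod.case]
  show "finite \<U>" using A by (elim conjE)
  show "{} \<notin> \<U>" using A by (elim conjE)
  show "bounded_in X U0" using A by (elim conjE)
  show "topspace X = U0 \<union> (\<Union>U\<in>\<U>. X closure_of U)" using A by (elim conjE)
  have op: "\<forall>U\<in>insert U0 \<U>. openin X U" using A by (elim conjE)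
  then show "openin X U0" "\<And>U. U \<in> \<U> \<Longrightarrow> openin X U" by blast+
  have co: "\<forall>U\<in>insert U0 \<U>. compactin X (X closure_of U - U)" using A by (elim conjE)
  then show "compactin X (X closure_of U0 - U0)" "\<And>U. U \<in> \<U> \<Longrightarrow> compactin X (X closure_of U - U)"
    by blast+
  have "pairwise disjnt \<U>" using A by (elim conjE)
  then show "\<And>U V. U \<in> \<U> \<Longrightarrow> V \<in> \<U> \<Longrightarrow> U \<noteq> V \<Longrightarrow> U \<inter> V = {}"
    by (simp add: pairwise_def disjnt_def)
  have "\<forall>U\<in>\<U>. disjnt U0 (X closure_of U)" using A by (elim conjE)
  then show "\<And>U. U \<in> \<U> \<Longrightarrow> U0 \<inter> X closure_of U = {}" by (simp add: disjnt_def)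
  have "pairwise (\<lambda>U V. disjnt (X closure_of U) (X closure_of V)) \<U>" using A by (elim conjE)
  then show "\<And>U V. U \<in> \<U> \<Longrightarrow> V \<in> \<U> \<Longrightarrow> U \<noteq> V \<Longrightarrow> X closure_of U \<inter> X closure_of V = {}"
    by (simp add: pairwise_def disjnt_def)
qed

lemma freudenthal_partition_pair:
  "freudenthal_partition X (U0, \<U>) = (\<lambda>x. {x}) ` U0 \<union> (\<lambda>U. X closure_of U) ` \<U>"
  by (simp add: freudenthal_partition_def)

text \<open>The complement consists of the finitely many remaining outer closures, hence is
  closed.\<close>

lemma openin_family_star:
  assumes "(U0, \<U>) \<in> freudenthal_families X" "\<V> \<subseteq> \<U>"
  shows "openin X (U0 \<union> (\<Union>V\<in>\<V>. X closure_of V))"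
proof -
  note D = freudenthal_familiesD[OF assms(1)]
  have "closedin X (\<Union>V\<in>\<U> - \<V>. X closure_of V)"
    using D(1) by (intro closedin_Union) auto
  moreover have "U0 \<union> (\<Union>V\<in>\<V>. X closure_of V) = topspace X - (\<Union>V\<in>\<U> - \<V>. X closure_of V)"
    unfolding D(9) using D(10,11) assms(2) by blast
  ultimately show ?thesis by auto
qed

locale locally_compact_Hausdorff =
  fixes X :: "'a topology"
  assumes Hausdorff: "Hausdorff_space X" and locally_compact: "locally_compact_space X"
begin

lemma closure_compact_if_bounded:
  assumes "bounded_in X S" shows "compactin X (X closure_of S)"
proof -
  obtain K where K: "compactin X K" "S \<subseteq> K" using assms unfolding bounded_in_def by blast
  have "closedin X K" using K(1) Hausdorff compactin_imp_closedin by blast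
  then have "X closure_of S \<subseteq> K" using K(2) closure_of_minimal by blast
  then show ?thesis using K(1) closed_compactin closedin_closure_of by metis
qed

text \<open>The interior of the closure of a relatively compact neighbourhood is regular and has the
  same closure. Such a \<open>W\<close> can serve as the core of a family.\<close>

lemma compact_subset_regular_open:
  assumes "compactin X K"
  obtains W where "openin X W" "X interior_of (X closure_of W) = W" "compactin X (X closure_of W)" "K \<subseteq> W"
proof -
  obtain V L where V: "openin X V" "compactin X L" "closedin X L" "K \<subseteq> V" "V \<subseteq> L"
    using locally_compact locally_compact_space_compact_closed_compact[of X] Hausdorff assms by metis
  define W where "W = X interior_of (X closure_of V)"
  have VW: "V \<subseteq> W"
    unfolding W_def by (metis V(1) closure_of_subset interior_of_maximal openin_subset)
  have cW: "X closure_of W = X closure_of V"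
    unfolding W_def using closure_of_mono[OF VW[unfolded W_def]] interior_of_subset
    by (metis closure_of_closure_of closure_of_mono subset_antisym)
  have "compactin X (X closure_of V)"
    using V closure_of_minimal closed_compactin closedin_closure_of by metis
  then show thesis
    using that[of W] cW VW V(4) W_def by auto
qed

text \<open>Regularity of \<open>W\<close> makes the closure of \<open>topspace X - X closure_of W\<close> equal to \<open>topspace X - W\<close>.\<close>

lemma family_of_open_cover:
  assumes W: "openin X W" "X interior_of (X closure_of W) = W" "compactin X (X closure_of W)"
    and G: "finite \<G>" "\<And>G. G \<in> \<G> \<Longrightarrow> openin X G" "pairwise disjnt \<G>"
    and cover: "topspace X - W \<subseteq> \<Union>\<G>"
  shows "(W, (\<lambda>G. G - X closure_of W) ` \<G> - {{}}) \<in> freudenthal_families X"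
    and "\<And>G. G \<in> \<G> \<Longrightarrow> X closure_of (G - X closure_of W) = G - W"
proof -
  have Gdisj: "G \<inter> H = {}" if "G \<in> \<G>" "H \<in> \<G>" "G \<noteq> H" for G H
    using G(3) that by (auto simp: pairwise_def disjnt_def)
  have Wc: "W \<subseteq> X closure_of W" using W(1) by (simp add: closure_of_subset openin_subset)
  show cl: "X closure_of (G - X closure_of W) = G - W" if "G \<in> \<G>" for G
  proof
    have "X closure_of (G - X closure_of W) \<subseteq> topspace X - W"
      using W(1) Wc G(2)[OF that] openin_subset by (intro closure_of_minimal) auto
    \<comment> \<open>The other members of the cover are open and disjoint from \<open>G\<close>, so
      they keep the closure out; what is left off \<open>W\<close> is covered by \<open>G\<close>
      alone.\<close>
    moreover have "X closure_of (G - X closure_of W) \<inter> H = {}" if "H \<in> \<G>" "H \<noteq> G" for H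
      using openin_Int_closure_of_eq_empty[OF G(2)[OF that(1)], of "G - X closure_of W"]
        Gdisj[OF \<open>G \<in> \<G>\<close> that(1)] that(2) by blast
    ultimately show "X closure_of (G - X closure_of W) \<subseteq> G - W" using cover by blast
    show "G - W \<subseteq> X closure_of (G - X closure_of W)"
    proof
      fix x assume x: "x \<in> G - W"
      show "x \<in> X closure_of (G - X closure_of W)"
        unfolding in_closure_of
      proof (intro conjI allI impI)
        show "x \<in> topspace X" using x G(2)[OF that] openin_subset by blast
        fix T assume T: "x \<in> T \<and> openin X T"
        \<comment> \<open>Regularity of \<open>W\<close> at work: an open set around a point off
          \<open>W\<close> cannot lie in the closure of \<open>W\<close>.\<close>
        have "\<not> T \<inter> G \<subseteq> X closure_of W"
          using x T W(2) G(2)[OF that] interior_of_maximal[of "T \<inter> G" "X closure_of W" X]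
          by (metis DiffE IntI openin_Int subsetD)
        then show "\<exists>y. y \<in> G - X closure_of W \<and> y \<in> T" by blast
      qed
    qed
  qed
  let ?\<U> = "(\<lambda>G. G - X closure_of W) ` \<G> - {{}}"
  \<comment> \<open>Discarding empty differences loses no part of the cover: if
    \<open>G - X closure_of W\<close> is empty, so is its closure \<open>G - W\<close>.\<close>
  have ne: "G - X closure_of W \<noteq> {}" if "G \<in> \<G>" "G - W \<noteq> {}" for G
    using cl[OF that(1)] that(2) by (metis closure_of_empty)
  have fr: "compactin X (G - W - (G - X closure_of W))" if "G \<in> \<G>" for G
  proof (rule closed_compactin[OF W(3)])
    show "G - W - (G - X closure_of W) \<subseteq> X closure_of W" by blast
    have "openin X (G - X closure_of W)" using G(2)[OF that] by (simp add: openin_diff)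
    then show "closedin X (G - W - (G - X closure_of W))"
      using cl[OF that] by (metis closedin_closure_of closedin_diff)
  qed
  have "topspace X = W \<union> (\<Union>U\<in>?\<U>. X closure_of U)"
  proof
    show "topspace X \<subseteq> W \<union> (\<Union>U\<in>?\<U>. X closure_of U)"
    proof
      fix x assume x: "x \<in> topspace X"
      show "x \<in> W \<union> (\<Union>U\<in>?\<U>. X closure_of U)"
      proof (cases "x \<in> W")
        case False
        then obtain G where g: "G \<in> \<G>" "x \<in> G - W" using x cover by blast
        then have "G - X closure_of W \<in> ?\<U>" using ne by blast
        then show ?thesis using cl[OF g(1)] g(2) by blast
      qed simp
    qed
    show "W \<union> (\<Union>U\<in>?\<U>. X closure_of U) \<subseteq> topspace X"
      using openin_subset[OF W(1)] closure_of_subset_topspace by (metis (no_types, lifting) UN_least Un_least)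
  qed
  moreover have "bounded_in X W" unfolding bounded_in_def using W(3) Wc by blast
  moreover have "compactin X (X closure_of W - W)"
    using W(1,3) by (metis Diff_subset closed_compactin closedin_closure_of closedin_diff)
  moreover have "finite ?\<U>" using G(1) by simp
  moreover have "\<forall>U\<in>?\<U>. openin X U" using G(2) by (auto simp: openin_diff)
  moreover have "\<forall>U\<in>?\<U>. compactin X (X closure_of U - U)" using fr by (auto simp: cl)
  moreover have "\<forall>U\<in>?\<U>. disjnt W U" using Wc by (auto simp: disjnt_iff)
  moreover have "\<forall>U\<in>?\<U>. disjnt W (X closure_of U)" by (auto simp: disjnt_iff cl)
  moreover have "pairwise disjnt ?\<U>" using Gdisj by (auto simp: pairwise_def disjnt_iff)
  moreover have "pairwise (\<lambda>U V. disjnt (X closure_of U) (X closure_of V)) ?\<U>"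
  proof (intro pairwiseI)
    fix U V assume "U \<in> ?\<U>" "V \<in> ?\<U>" "U \<noteq> V"
    then obtain G H where "G \<in> \<G>" "H \<in> \<G>" "G \<noteq> H" "U = G - X closure_of W" "V = H - X closure_of W"
      by blast
    then show "disjnt (X closure_of U) (X closure_of V)"
      using cl Gdisj[of G H] by (auto simp: disjnt_def)
  qed
  ultimately show "(W, ?\<U>) \<in> freudenthal_families X"
    unfolding freudenthal_families_def using W(1) by simp
qed

lemma freudenthal_family_above_compact:
  assumes "compactin X K"
  obtains W \<W> where "(W, \<W>) \<in> freudenthal_families X" "K \<subseteq> W"
proof -
  obtain W where W: "openin X W" "X interior_of (X closure_of W) = W" "compactin X (X closure_of W)" "K \<subseteq> W"
    using compact_subset_regular_open[OF assms] by metis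
  have "(W, (\<lambda>G. G - X closure_of W) ` {topspace X} - {{}}) \<in> freudenthal_families X"
    by (rule family_of_open_cover(1)[OF W(1-3)]) auto
  then show thesis using that W(4) by blast
qed

text \<open>Once the new core contains both old cores and all old frontiers, every point outside it
  lies in an intersection of outer members. The prescribed compact set \<open>K\<close> is what
  later shows blocks of ends to be unbounded.\<close>

lemma freudenthal_families_directed:
  assumes "\<UU> \<in> freudenthal_families X" "\<VV> \<in> freudenthal_families X" "compactin X K"
  obtains \<WW> where "\<WW> \<in> freudenthal_families X" "freudenthal_le X \<UU> \<WW>" "freudenthal_le X \<VV> \<WW>"
    "K \<subseteq> fst \<WW>"
proof -
  obtain U0 \<U> V0 \<V> where eq: "\<UU> = (U0, \<U>)" "\<VV> = (V0, \<V>)" by (metis surj_pair)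
  note U = freudenthal_familiesD[OF assms(1)[unfolded eq]]
  note V = freudenthal_familiesD[OF assms(2)[unfolded eq]]
  define L where "L = K \<union> (X closure_of U0 \<union> X closure_of V0)
    \<union> ((\<Union>U\<in>\<U>. X closure_of U - U) \<union> (\<Union>V\<in>\<V>. X closure_of V - V))"
  have "compactin X L"
    unfolding L_def using assms(3) U V closure_compact_if_bounded
    by (intro compactin_Un compactin_Union) auto
  then obtain W where W: "openin X W" "X interior_of (X closure_of W) = W" "compactin X (X closure_of W)" "L \<subseteq> W"
    using compact_subset_regular_open by metis
  define \<G> where "\<G> = (\<lambda>(U, V). U \<inter> V) ` (\<U> \<times> \<V>)"
  have sub: "U0 \<subseteq> W" "V0 \<subseteq> W"
    using W(4) closure_of_subset[OF openin_subset[OF U(3)]] closure_of_subset[OF openin_subset[OF V(3)]]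
    unfolding L_def by blast+
  have cU: "X closure_of S - S \<subseteq> W" if "S \<in> \<U>" for S using W(4) that unfolding L_def by blast
  have cV: "X closure_of S - S \<subseteq> W" if "S \<in> \<V>" for S using W(4) that unfolding L_def by blast
  have cover: "topspace X - W \<subseteq> \<Union>\<G>"
  proof
    fix x assume x: "x \<in> topspace X - W"
    obtain S where "S \<in> \<U>" "x \<in> X closure_of S" using x U(9) sub by blast
    moreover obtain T where "T \<in> \<V>" "x \<in> X closure_of T" using x V(9) sub by blast
    ultimately have "S \<in> \<U>" "T \<in> \<V>" "x \<in> S \<inter> T" using cU cV x by blast+
    then show "x \<in> \<Union>\<G>" unfolding \<G>_def by blast
  qed
  have G: "finite \<G>" "\<And>G. G \<in> \<G> \<Longrightarrow> openin X G" "pairwise disjnt \<G>"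
  proof -
    show "finite \<G>" unfolding \<G>_def using U(1) V(1) by blast
    show "openin X G" if "G \<in> \<G>" for G using that U(4) V(4) unfolding \<G>_def by auto
    show "pairwise disjnt \<G>"
      unfolding \<G>_def pairwise_def disjnt_def using U(5) V(5) by fastforce
  qed
  define \<W> where "\<W> = (\<lambda>G. G - X closure_of W) ` \<G> - {{}}"
  have fam: "(W, \<W>) \<in> freudenthal_families X"
    and cl: "\<And>G. G \<in> \<G> \<Longrightarrow> X closure_of (G - X closure_of W) = G - W"
    unfolding \<W>_def using family_of_open_cover[OF W(1-3) G cover] by blast+
  have le: "freudenthal_le X (S0, \<S>) (W, \<W>)"
    if fS: "(S0, \<S>) \<in> freudenthal_families X" and GS: "\<And>G. G \<in> \<G> \<Longrightarrow> \<exists>S\<in>\<S>. G \<subseteq> S" for S0 \<S>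
    unfolding freudenthal_le_def refines_def
  proof (intro conjI ballI)
    note pS = partition_on_freudenthal_partition[OF fS]
    show "partition_on (topspace X) (freudenthal_partition X (S0, \<S>))" by (rule pS)
    show "partition_on (topspace X) (freudenthal_partition X (W, \<W>))"
      by (rule partition_on_freudenthal_partition[OF fam])
    fix B assume "B \<in> freudenthal_partition X (W, \<W>)"
    then consider x where "x \<in> W" "B = {x}" | G where "G \<in> \<G>" "B = G - W"
      unfolding freudenthal_partition_pair \<W>_def using cl by auto
    then show "\<exists>C\<in>freudenthal_partition X (S0, \<S>). B \<subseteq> C"
    proof cases
      case 1
      then have "x \<in> topspace X" using W(1) openin_subset by blast
      then show ?thesis using block_of[OF pS] 1 by blast
    next
      case 2
      then obtain S where S: "S \<in> \<S>" "G \<subseteq> S" using GS by blast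
      then have "G \<subseteq> X closure_of S"
        using freudenthal_familiesD(4)[OF fS S(1)] by (meson closure_of_subset openin_subset order_trans)
      then show ?thesis unfolding freudenthal_partition_pair using S(1) 2 by blast
    qed
  qed
  show thesis
  proof (rule that[OF fam])
    show "freudenthal_le X \<UU> (W, \<W>)" "freudenthal_le X \<VV> (W, \<W>)"
      unfolding eq using assms(1,2) eq by (auto intro!: le simp: \<G>_def)
    show "K \<subseteq> fst (W, \<W>)" using W(4) unfolding L_def by auto
  qed
qed

lemma freudenthal_families_directed_finite:
  assumes "finite \<F>" "\<F> \<subseteq> freudenthal_families X"
  shows "\<exists>\<WW>\<in>freudenthal_families X. \<forall>\<UU>\<in>\<F>. freudenthal_le X \<UU> \<WW>"
  using assms
proof (induction \<F>)
  case empty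
  obtain W \<W> where "(W, \<W>) \<in> freudenthal_families X"
    using freudenthal_family_above_compact[OF compactin_empty] by metis
  then show ?case by blast
next
  case (insert \<UU> \<F>)
  then obtain \<VV> where V: "\<VV> \<in> freudenthal_families X" "\<forall>\<UU>\<in>\<F>. freudenthal_le X \<UU> \<VV>" by blast
  obtain \<WW> where "\<WW> \<in> freudenthal_families X" "freudenthal_le X \<UU> \<WW>" "freudenthal_le X \<VV> \<WW>"
    using freudenthal_families_directed[OF _ V(1) compactin_empty] insert.prems by (metis insert_subset)
  then show ?case using V(2) refines_trans unfolding freudenthal_le_def by blast
qed

end

section \<open>Points of the Freudenthal compactification\<close>

lemma topspace_freudenthal:
  "topspace (freudenthal X) =
     {\<xi> \<in> \<Pi>\<^sub>E \<UU>\<in>freudenthal_families X. freudenthal_partition X \<UU>.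
        \<forall>\<UU>\<in>freudenthal_families X. \<forall>\<VV>\<in>freudenthal_families X.
          freudenthal_le X \<UU> \<VV> \<longrightarrow> freudenthal_bond X \<UU> \<VV> (\<xi> \<VV>) = \<xi> \<UU>}"
proof -
  have "(\<Pi>\<^sub>E \<UU>\<in>freudenthal_families X. topspace (quotient_topology X (freudenthal_partition X \<UU>)))
      = (\<Pi>\<^sub>E \<UU>\<in>freudenthal_families X. freudenthal_partition X \<UU>)"
    by (intro PiE_cong topspace_quotient_topology partition_on_freudenthal_partition)
  then show ?thesis
    unfolding freudenthal_def inverse_limit_def topspace_subtopology topspace_product_topology o_def by auto
qed

lemma freudenthal_component:
  assumes "\<xi> \<in> topspace (freudenthal X)" "\<UU> \<in> freudenthal_families X"
  shows "\<xi> \<UU> \<in> freudenthal_partition X \<UU>" "\<xi> \<UU> \<noteq> {}" "\<xi> \<UU> \<subseteq> topspace X"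
proof -
  show *: "\<xi> \<UU> \<in> freudenthal_partition X \<UU>"
    using assms unfolding topspace_freudenthal by blast
  note p = partition_on_freudenthal_partition[OF assms(2)]
  show "\<xi> \<UU> \<noteq> {}" using * partition_onD3[OF p] by metis
  show "\<xi> \<UU> \<subseteq> topspace X" using * partition_onD1[OF p] by blast
qed

text \<open>Bonding maps send a block to the block containing it, so a point of the inverse limit is
  a shrinking thread of blocks.\<close>

lemma freudenthal_component_antimono:
  assumes "\<xi> \<in> topspace (freudenthal X)" "\<UU> \<in> freudenthal_families X" "\<VV> \<in> freudenthal_families X"
    and le: "freudenthal_le X \<UU> \<VV>"
  shows "\<xi> \<VV> \<subseteq> \<xi> \<UU>"
proof -
  obtain C where C: "C \<in> freudenthal_partition X \<UU>" "\<xi> \<VV> \<subseteq> C"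
    using le freudenthal_component(1)[OF assms(1,3)] unfolding freudenthal_le_def refines_def by blast
  have "freudenthal_bond X \<UU> \<VV> (\<xi> \<VV>) = C"
    using freudenthal_bond_unique[OF le freudenthal_component(1)[OF assms(1,3)] C] .
  moreover have "freudenthal_bond X \<UU> \<VV> (\<xi> \<VV>) = \<xi> \<UU>"
    using assms unfolding topspace_freudenthal by blast
  ultimately show ?thesis using C(2) by simp
qed

lemma freudenthal_embed_component:
  assumes "\<UU> \<in> freudenthal_families X"
  shows "freudenthal_embed X x \<UU> = block_of (freudenthal_partition X \<UU>) x"
  using assms by (simp add: freudenthal_embed_def)

lemma freudenthal_eq_embed_iff:
  assumes "\<xi> \<in> topspace (freudenthal X)" "x \<in> topspace X"
  shows "\<xi> = freudenthal_embed X x \<longleftrightarrow> (\<forall>\<UU>\<in>freudenthal_families X. x \<in> \<xi> \<UU>)"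
proof
  assume "\<xi> = freudenthal_embed X x"
  then show "\<forall>\<UU>\<in>freudenthal_families X. x \<in> \<xi> \<UU>"
    using block_of(2)[OF partition_on_freudenthal_partition assms(2)] by (simp add: freudenthal_embed_component)
next
  assume *: "\<forall>\<UU>\<in>freudenthal_families X. x \<in> \<xi> \<UU>"
  show "\<xi> = freudenthal_embed X x"
  proof (rule extensionalityI)
    show "\<xi> \<in> extensional (freudenthal_families X)"
      using assms(1) unfolding topspace_freudenthal PiE_def by blast
    show "freudenthal_embed X x \<in> extensional (freudenthal_families X)"
      unfolding freudenthal_embed_def by (rule restrict_extensional)
    fix \<UU> assume U: "\<UU> \<in> freudenthal_families X"
    show "\<xi> \<UU> = freudenthal_embed X x \<UU>"
      unfolding freudenthal_embed_component[OF U]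
      using block_of_unique[OF partition_on_freudenthal_partition[OF U] freudenthal_component(1)[OF assms(1) U]]
        * U by simp
  qed
qed

lemma end_in_topspace: "e \<in> ends X \<Longrightarrow> e \<in> topspace (freudenthal X)"
  by (simp add: ends_def)

lemma topspace_end_space: "topspace (end_space X) = ends X"
  unfolding end_space_def topspace_subtopology by (auto simp: ends_def)

section \<open>Saturated sets and cylinders\<close>

text \<open>For \<open>Q\<close> inside a partitioned space this says that \<open>Q\<close> is a
  union of blocks, so that an open \<open>Q\<close> descends to an open set of the quotient.\<close>

definition saturated :: "'a set set \<Rightarrow> 'a set \<Rightarrow> bool" where
  "saturated P Q \<longleftrightarrow> (\<forall>B\<in>P. B \<subseteq> Q \<or> B \<inter> Q = {})"

lemma openin_quotient_saturated:
  assumes p: "partition_on (topspace X) P" and "openin X Q" "saturated P Q"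
  shows "openin (quotient_topology X P) {B \<in> P. B \<subseteq> Q}"
proof -
  have "\<Union>{B \<in> P. B \<subseteq> Q} = Q"
  proof
    show "Q \<subseteq> \<Union>{B \<in> P. B \<subseteq> Q}"
    proof
      fix x assume x: "x \<in> Q"
      then have "x \<in> topspace X" using openin_subset[OF assms(2)] by blast
      then obtain B where "B \<in> P" "x \<in> B" using block_of[OF p] by blast
      then show "x \<in> \<Union>{B \<in> P. B \<subseteq> Q}" using assms(3) x unfolding saturated_def by blast
    qed
  qed blast
  then show ?thesis unfolding openin_quotient_topology[OF p] using assms(2) by auto
qed

text \<open>The core is split into singletons, so any part \<open>A\<close> of it may be kept, while
  outer blocks are kept or dropped whole.\<close>

lemma saturated_family_star:
  assumes "(U0, \<U>) \<in> freudenthal_families X" "A \<subseteq> U0" "\<V> \<subseteq> \<U>"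
  shows "saturated (freudenthal_partition X (U0, \<U>)) (A \<union> (\<Union>V\<in>\<V>. X closure_of V))"
  unfolding saturated_def freudenthal_partition_pair
proof
  note D = freudenthal_familiesD(10,11)[OF assms(1)]
  fix B assume "B \<in> (\<lambda>x. {x}) ` U0 \<union> (\<lambda>U. X closure_of U) ` \<U>"
  then consider x where "B = {x}" | U where "U \<in> \<U>" "B = X closure_of U" by blast
  then show "B \<subseteq> A \<union> (\<Union>V\<in>\<V>. X closure_of V) \<or> B \<inter> (A \<union> (\<Union>V\<in>\<V>. X closure_of V)) = {}"
  proof cases
    case 2
    show ?thesis
    proof (cases "U \<in> \<V>")
      case False
      have "B \<inter> X closure_of V = {}" if "V \<in> \<V>" for V
        using D(2)[OF 2(1), of V] that False assms(3) 2(2) by blast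
      moreover have "B \<inter> A = {}" using D(1)[OF 2(1)] assms(2) 2(2) by blast
      ultimately show ?thesis by blast
    qed (use 2 in blast)
  qed blast
qed

text \<open>The preimage, under the projection to the quotient of \<open>\<UU>\<close>, of the set
  of blocks inside \<open>Q\<close>; it is open if \<open>Q\<close> is open and saturated.\<close>

definition cylinder :: "'a topology \<Rightarrow> 'a pointed_family \<Rightarrow> 'a set \<Rightarrow> ('a pointed_family \<Rightarrow> 'a set) set" where
  "cylinder X \<UU> Q = {\<xi> \<in> topspace (freudenthal X). \<xi> \<UU> \<subseteq> Q}"

lemma openin_cylinder:
  assumes U: "\<UU> \<in> freudenthal_families X" and "openin X Q" "saturated (freudenthal_partition X \<UU>) Q"
  shows "openin (freudenthal X) (cylinder X \<UU> Q)"
proof -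
  have "continuous_map (freudenthal X) (quotient_topology X (freudenthal_partition X \<UU>)) (\<lambda>\<xi>. \<xi> \<UU>)"
    unfolding freudenthal_def inverse_limit_def
    by (intro continuous_map_from_subtopology continuous_map_product_projection U)
  from openin_continuous_map_preimage[OF this
      openin_quotient_saturated[OF partition_on_freudenthal_partition[OF U] assms(2,3)]]
  have "openin (freudenthal X) {\<xi> \<in> topspace (freudenthal X). \<xi> \<UU> \<in> {B \<in> freudenthal_partition X \<UU>. B \<subseteq> Q}}" .
  moreover have "{\<xi> \<in> topspace (freudenthal X). \<xi> \<UU> \<in> {B \<in> freudenthal_partition X \<UU>. B \<subseteq> Q}} = cylinder X \<UU> Q"
    unfolding cylinder_def using freudenthal_component(1)[OF _ U] by blast
  ultimately show ?thesis by simp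
qed

lemma embed_in_cylinder_iff:
  assumes U: "\<UU> \<in> freudenthal_families X" and x: "x \<in> topspace X"
    and sat: "saturated (freudenthal_partition X \<UU>) Q"
  shows "freudenthal_embed X x \<in> cylinder X \<UU> Q \<longleftrightarrow> x \<in> Q"
proof -
  note b = block_of[OF partition_on_freudenthal_partition[OF U] x]
  show ?thesis
    unfolding cylinder_def mem_Collect_eq freudenthal_embed_component[OF U]
    using b sat freudenthal_embed_in_topspace[OF x] unfolding saturated_def by blast
qed

lemma openin_cylinder_star:
  assumes "(U0, \<U>) \<in> freudenthal_families X" "\<V> \<subseteq> \<U>"
  shows "openin (freudenthal X) (cylinder X (U0, \<U>) (U0 \<union> (\<Union>V\<in>\<V>. X closure_of V)))"
  by (rule openin_cylinder[OF assms(1) openin_family_star[OF assms]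
      saturated_family_star[OF assms(1) order_refl assms(2)]])

text \<open>The complement is the cylinder over the core together with all other outer blocks, which
  is an open set.\<close>

lemma closedin_component_fibre:
  assumes f: "(U0, \<U>) \<in> freudenthal_families X" and "U \<in> \<U>"
  shows "closedin (freudenthal X) {\<xi> \<in> topspace (freudenthal X). \<xi> (U0, \<U>) = X closure_of U}"
proof -
  let ?Q = "U0 \<union> (\<Union>V\<in>\<U> - {U}. X closure_of V)"
  have "\<xi> (U0, \<U>) = X closure_of U \<longleftrightarrow> \<not> \<xi> (U0, \<U>) \<subseteq> ?Q" if xi: "\<xi> \<in> topspace (freudenthal X)" for \<xi>
  proof -
    note D = freudenthal_familiesD[OF f]
    note c = freudenthal_component[OF xi f]
    have disj: "X closure_of U \<inter> ?Q = {}" using D(10,11) assms(2) by blast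
    from c(1) consider x where "x \<in> U0" "\<xi> (U0, \<U>) = {x}" | V where "V \<in> \<U>" "\<xi> (U0, \<U>) = X closure_of V"
      unfolding freudenthal_partition_pair by (elim UnE imageE)
    then show ?thesis
    proof cases
      case 1
      then show ?thesis using D(10)[OF assms(2)] by auto
    next
      case 2
      show ?thesis
      proof (cases "V = U")
        case True
        then show ?thesis using 2 disj c(2) by auto
      next
        case False
        then have "X closure_of V \<noteq> X closure_of U" using D(11)[OF 2(1) assms(2)] c(2) 2(2) by auto
        then show ?thesis using 2 False by auto
      qed
    qed
  qed
  then have "{\<xi> \<in> topspace (freudenthal X). \<xi> (U0, \<U>) = X closure_of U}
      = topspace (freudenthal X) - cylinder X (U0, \<U>) ?Q"
    unfolding cylinder_def by blast
  then show ?thesis using openin_cylinder_star[OF f, of "\<U> - {U}"] by auto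
qed

text \<open>Core blocks are singletons inside \<open>U0\<close>, so only outer blocks remain. Ends
  satisfy the last hypothesis by \<open>end_notin_core\<close>.\<close>

lemma end_component:
  assumes "e \<in> topspace (freudenthal X)" "(U0, \<U>) \<in> freudenthal_families X"
    "e \<notin> cylinder X (U0, \<U>) U0"
  obtains U where "U \<in> \<U>" "e (U0, \<U>) = X closure_of U"
proof -
  have "e (U0, \<U>) \<in> (\<lambda>x. {x}) ` U0 \<union> (\<lambda>U. X closure_of U) ` \<U>"
    using freudenthal_component(1)[OF assms(1,2)] unfolding freudenthal_partition_pair .
  moreover have "e (U0, \<U>) \<noteq> {x}" if "x \<in> U0" for x
    using assms(1,3) that unfolding cylinder_def by auto
  ultimately show thesis using that by auto
qed

section \<open>Compactness and the ends\<close>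

context locally_compact_Hausdorff
begin

text \<open>The closure of the core is compact, and its image together with finitely many outer
  blocks is the whole quotient.\<close>

lemma compact_space_freudenthal_quotient:
  assumes f: "\<UU> \<in> freudenthal_families X"
  shows "compact_space (quotient_topology X (freudenthal_partition X \<UU>))" (is "compact_space ?Q")
proof -
  obtain U0 \<U> where eq: "\<UU> = (U0, \<U>)" by (cases \<UU>)
  note D = freudenthal_familiesD[OF f[unfolded eq]]
  note p = partition_on_freudenthal_partition[OF f]
  let ?P = "freudenthal_partition X \<UU>"
  let ?q = "block_of ?P"
  have top: "topspace ?Q = ?P" by (rule topspace_quotient_topology[OF p])
  have "compactin ?Q (?q ` (X closure_of U0))"
    using closure_compact_if_bounded[OF D(6)] quotient_imp_continuous_map[OF quotient_map_block_of[OF p]]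
    by (rule image_compactin)
  moreover have fin: "compactin ?Q ((\<lambda>U. X closure_of U) ` \<U>)"
  proof (rule finite_imp_compactin)
    show "(\<lambda>U. X closure_of U) ` \<U> \<subseteq> topspace ?Q"
      unfolding top unfolding eq freudenthal_partition_pair by blast
  qed (use D(1) in blast)
  ultimately have "compactin ?Q (?q ` (X closure_of U0) \<union> (\<lambda>U. X closure_of U) ` \<U>)"
    by (rule compactin_Un)
  moreover have "?q ` (X closure_of U0) \<union> (\<lambda>U. X closure_of U) ` \<U> = ?P"
  proof
    have "X closure_of U0 \<subseteq> topspace X" by (rule closure_of_subset_topspace)
    then show "?q ` (X closure_of U0) \<union> (\<lambda>U. X closure_of U) ` \<U> \<subseteq> ?P"
      using block_of(1)[OF p] unfolding eq freudenthal_partition_pair by blast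
    have "{x} \<in> ?q ` (X closure_of U0)" if "x \<in> U0" for x
    proof
      show "{x} = ?q x"
        using block_of_unique[OF p, of "{x}" x] that unfolding eq freudenthal_partition_pair by auto
      show "x \<in> X closure_of U0" using that closure_of_subset[OF openin_subset[OF D(3)]] by blast
    qed
    then show "?P \<subseteq> ?q ` (X closure_of U0) \<union> (\<lambda>U. X closure_of U) ` \<U>"
      unfolding eq freudenthal_partition_pair by blast
  qed
  ultimately show ?thesis unfolding compact_space_def top by simp
qed

text \<open>One shape for both sorts of block, a compact part and an open part: a point with
  \<open>V\<close> empty, or a frontier with the outer member itself. Only the compact parts then
  have to be separated by hand.\<close>

lemma freudenthal_block_cases:
  assumes f: "(U0, \<U>) \<in> freudenthal_families X" and B: "B \<in> freudenthal_partition X (U0, \<U>)"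
  obtains K V where "compactin X K" "openin X V" "B = K \<union> V" "V \<inter> U0 = {}" "openin X (U0 \<union> B)"
proof -
  note D = freudenthal_familiesD[OF f]
  consider x where "x \<in> U0" "B = {x}" | U where "U \<in> \<U>" "B = X closure_of U"
    using B unfolding freudenthal_partition_pair by blast
  then show thesis
  proof cases
    case 1
    have "compactin X {x}" using D(3) 1(1) openin_subset by fastforce
    moreover have "U0 \<union> B = U0" using 1 by blast
    ultimately show ?thesis using that[of "{x}" "{}"] 1 D(3) by simp
  next
    case 2
    have "U \<subseteq> X closure_of U" using D(4)[OF 2(1)] by (simp add: closure_of_subset openin_subset)
    moreover have "openin X (U0 \<union> B)"
      using openin_family_star[OF f, of "{U}"] 2 by simp
    ultimately show ?thesis
      using that[OF D(8)[OF 2(1)] D(4)[OF 2(1)]] 2(2) D(10)[OF 2(1)] by blast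
  qed
qed

lemma Hausdorff_space_freudenthal_quotient:
  assumes f: "\<UU> \<in> freudenthal_families X"
  shows "Hausdorff_space (quotient_topology X (freudenthal_partition X \<UU>))" (is "Hausdorff_space ?Q")
proof -
  obtain U0 \<U> where eq: "\<UU> = (U0, \<U>)" by (cases \<UU>)
  note f' = f[unfolded eq]
  note p = partition_on_freudenthal_partition[OF f']
  let ?P = "freudenthal_partition X (U0, \<U>)"
  have disj: "B \<inter> C = {}" if "B \<in> ?P" "C \<in> ?P" "B \<noteq> C" for B C
    using partition_on_eq[OF p that(1,2)] that(3) by blast
  have single: "(\<exists>x. D = {x}) \<or> D \<inter> U0 = {}" if "D \<in> ?P" for D
    using that freudenthal_familiesD(10)[OF f'] unfolding freudenthal_partition_pair by blast
  show ?thesis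
    unfolding eq Hausdorff_space_def topspace_quotient_topology[OF p]
  proof (intro allI impI, elim conjE)
    fix B C assume BC: "B \<in> ?P" "C \<in> ?P" "B \<noteq> C"
    obtain K V where B: "compactin X K" "openin X V" "B = K \<union> V" "V \<inter> U0 = {}" "openin X (U0 \<union> B)"
      using freudenthal_block_cases[OF f' BC(1)] by metis
    obtain L W where C: "compactin X L" "openin X W" "C = L \<union> W" "W \<inter> U0 = {}" "openin X (U0 \<union> C)"
      using freudenthal_block_cases[OF f' BC(2)] by metis
    have BC0: "B \<inter> C = {}" by (rule disj[OF BC])
    then have "disjnt K L" using B(3) C(3) by (auto simp: disjnt_def)
    then obtain S T where ST: "openin X S" "openin X T" "K \<subseteq> S" "L \<subseteq> T" "disjnt S T"
      using Hausdorff_space_compact_separation[OF Hausdorff B(1) C(1)] by metis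
    \<comment> \<open>The separating sets are cut down to the core and the block in question, so
      that beyond this block they meet only singleton blocks; the open parts are added back
      whole.\<close>
    define S' where "S' = (S \<inter> (U0 \<union> B)) \<union> V"
    define T' where "T' = (T \<inter> (U0 \<union> C)) \<union> W"
    have op: "openin X S'" "openin X T'" unfolding S'_def T'_def using B C ST by blast+
    have sub: "B \<subseteq> S'" "C \<subseteq> T'" "S' \<subseteq> U0 \<union> B" "T' \<subseteq> U0 \<union> C"
      unfolding S'_def T'_def using B(3) C(3) ST(3,4) by blast+
    have sat_if: "saturated ?P R" if A: "A \<in> ?P" "A \<subseteq> R" "R \<subseteq> U0 \<union> A" for A R
      unfolding saturated_def
    proof
      fix D assume D: "D \<in> ?P"
      show "D \<subseteq> R \<or> D \<inter> R = {}"
      proof (cases "D = A")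
        case False
        then have "D \<inter> A = {}" using disj D A(1) by metis
        then show ?thesis using single[OF D] A(3) by auto
      qed (use A in auto)
    qed
    have sat: "saturated ?P S'" "saturated ?P T'"
      using sat_if[OF BC(1) sub(1,3)] sat_if[OF BC(2) sub(2,4)] by auto
    have "S' \<inter> T' = {}"
      using ST(5) B(3,4) C(3,4) BC0 unfolding S'_def T'_def disjnt_def by blast
    then have "\<not> (D \<subseteq> S' \<and> D \<subseteq> T')" if "D \<in> ?P" for D
      using that partition_onD3[OF p] by (metis Int_subset_iff subset_empty)
    then have "disjnt {D \<in> ?P. D \<subseteq> S'} {D \<in> ?P. D \<subseteq> T'}"
      unfolding disjnt_def by blast
    then show "\<exists>S T. openin (quotient_topology X ?P) S \<and> openin (quotient_topology X ?P) T \<and> B \<in> S \<and> C \<in> T \<and> disjnt S T"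
      using openin_quotient_saturated[OF p op(1) sat(1)] openin_quotient_saturated[OF p op(2) sat(2)] BC sub(1,2)
      by (intro exI[of _ "{D \<in> ?P. D \<subseteq> S'}"] exI[of _ "{D \<in> ?P. D \<subseteq> T'}"]) simp
  qed
qed

text \<open>Continuity out of a quotient can be tested on \<open>X\<close>, where the bonding map
  becomes the projection for \<open>\<UU>\<close>, because \<open>freudenthal_embed X x\<close> is a
  thread.\<close>

lemma continuous_map_freudenthal_bond:
  assumes "\<UU> \<in> freudenthal_families X" "\<VV> \<in> freudenthal_families X" "freudenthal_le X \<UU> \<VV>"
  shows "continuous_map (quotient_topology X (freudenthal_partition X \<VV>))
           (quotient_topology X (freudenthal_partition X \<UU>)) (freudenthal_bond X \<UU> \<VV>)"
proof (rule continuous_compose_quotient_map)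
  show "quotient_map X (quotient_topology X (freudenthal_partition X \<VV>)) (block_of (freudenthal_partition X \<VV>))"
    by (intro quotient_map_block_of partition_on_freudenthal_partition assms)
  have "continuous_map X (quotient_topology X (freudenthal_partition X \<UU>)) (block_of (freudenthal_partition X \<UU>))"
    by (intro quotient_imp_continuous_map quotient_map_block_of partition_on_freudenthal_partition assms)
  moreover have "block_of (freudenthal_partition X \<UU>) x
      = (freudenthal_bond X \<UU> \<VV> \<circ> block_of (freudenthal_partition X \<VV>)) x" if "x \<in> topspace X" for x
    using freudenthal_embed_in_topspace[OF that] assms unfolding topspace_freudenthal
    by (simp add: freudenthal_embed_component)
  ultimately show "continuous_map X (quotient_topology X (freudenthal_partition X \<UU>))
      (freudenthal_bond X \<UU> \<VV> \<circ> block_of (freudenthal_partition X \<VV>))"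
    by (rule continuous_map_eq)
qed

text \<open>Tychonoff, once the inverse limit is seen to be closed in the product: each bonding
  equation equates two continuous maps into a Hausdorff quotient.\<close>

lemma compact_space_freudenthal: "compact_space (freudenthal X)"
proof -
  let ?I = "freudenthal_families X"
  let ?\<Pi> = "product_topology (\<lambda>\<UU>. quotient_topology X (freudenthal_partition X \<UU>)) ?I"
  define E where "E \<UU> \<VV> = {\<xi> \<in> topspace ?\<Pi>. freudenthal_bond X \<UU> \<VV> (\<xi> \<VV>) = \<xi> \<UU>}" for \<UU> \<VV>
  \<comment> \<open>The whole product is inserted so that the intersection is over a nonempty family
    and stays in the product.\<close>
  define \<E> where "\<E> = insert (topspace ?\<Pi>) {E \<UU> \<VV> |\<UU> \<VV>. \<UU> \<in> ?I \<and> \<VV> \<in> ?I \<and> freudenthal_le X \<UU> \<VV>}"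
  have "closedin ?\<Pi> (E \<UU> \<VV>)" if "\<UU> \<in> ?I" "\<VV> \<in> ?I" "freudenthal_le X \<UU> \<VV>" for \<UU> \<VV>
    unfolding E_def
  proof (rule closedin_continuous_maps_eq[OF Hausdorff_space_freudenthal_quotient[OF that(1)]])
    show "continuous_map ?\<Pi> (quotient_topology X (freudenthal_partition X \<UU>)) (\<lambda>\<xi>. freudenthal_bond X \<UU> \<VV> (\<xi> \<VV>))"
    proof -
      have "continuous_map ?\<Pi> (quotient_topology X (freudenthal_partition X \<VV>)) (\<lambda>\<xi>. \<xi> \<VV>)"
        by (rule continuous_map_product_projection[OF that(2)])
      from continuous_map_compose[OF this continuous_map_freudenthal_bond[OF that]]
      show ?thesis by (simp add: o_def)
    qed
    show "continuous_map ?\<Pi> (quotient_topology X (freudenthal_partition X \<UU>)) (\<lambda>\<xi>. \<xi> \<UU>)"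
      by (rule continuous_map_product_projection[OF that(1)])
  qed
  then have "closedin ?\<Pi> S" if "S \<in> \<E>" for S
    using that closedin_topspace unfolding \<E>_def by blast
  then have "closedin ?\<Pi> (\<Inter>\<E>)"
    by (intro closedin_Inter) (simp_all add: \<E>_def)
  moreover have "compact_space ?\<Pi>"
    unfolding compact_space_product_topology using compact_space_freudenthal_quotient by blast
  ultimately have "compactin ?\<Pi> (\<Inter>\<E>)" using closedin_compact_space by blast
  moreover have "freudenthal X = subtopology ?\<Pi> (\<Inter>\<E>)"
  proof -
    define S where "S = {\<xi>. \<forall>i\<in>?I. \<forall>j\<in>?I. freudenthal_le X i j \<longrightarrow> freudenthal_bond X i j (\<xi> j) = \<xi> i}"
    have "\<Inter>\<E> = topspace ?\<Pi> \<inter> S"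
    proof
      have "\<xi> \<in> S" if "\<xi> \<in> \<Inter>\<E>" for \<xi>
        unfolding S_def mem_Collect_eq
      proof (intro ballI impI)
        fix i j assume "i \<in> ?I" "j \<in> ?I" "freudenthal_le X i j"
        then have "E i j \<in> \<E>" unfolding \<E>_def by blast
        then have "\<xi> \<in> E i j" using that by (rule InterD[rotated])
        then show "freudenthal_bond X i j (\<xi> j) = \<xi> i" unfolding E_def by (elim CollectE conjE)
      qed
      then show "\<Inter>\<E> \<subseteq> topspace ?\<Pi> \<inter> S" unfolding \<E>_def by blast
      show "topspace ?\<Pi> \<inter> S \<subseteq> \<Inter>\<E>"
      proof (intro subsetI InterI)
        fix \<xi> A assume xi: "\<xi> \<in> topspace ?\<Pi> \<inter> S" and "A \<in> \<E>"
        then consider "A = topspace ?\<Pi>" | i j where "A = E i j" "i \<in> ?I" "j \<in> ?I" "freudenthal_le X i j"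
          unfolding \<E>_def by blast
        then show "\<xi> \<in> A"
        proof cases
          case 2
          then show ?thesis using xi unfolding S_def E_def by simp
        qed (use xi in blast)
      qed
    qed
    moreover have "freudenthal X = subtopology ?\<Pi> S"
      unfolding freudenthal_def inverse_limit_def S_def ..
    ultimately show ?thesis by (metis subtopology_restrict)
  qed
  ultimately show ?thesis using compact_space_subtopology by simp
qed

text \<open>The block in \<open>(U0, \<U>)\<close> is a singleton \<open>{x}\<close>. In a common
  refinement with any other family the nonempty block lies inside \<open>{x}\<close>, so
  \<open>x\<close> belongs to every block of the thread.\<close>

lemma freudenthal_core:
  assumes f: "(U0, \<U>) \<in> freudenthal_families X" and xi: "\<xi> \<in> cylinder X (U0, \<U>) U0"
  obtains x where "x \<in> U0" "\<xi> = freudenthal_embed X x"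
proof -
  have top: "\<xi> \<in> topspace (freudenthal X)" and sub: "\<xi> (U0, \<U>) \<subseteq> U0"
    using xi unfolding cylinder_def by auto
  obtain x where x: "x \<in> U0" "\<xi> (U0, \<U>) = {x}"
    using freudenthal_component(1,2)[OF top f] sub freudenthal_familiesD(10)[OF f]
    unfolding freudenthal_partition_pair by blast
  have xX: "x \<in> topspace X" using freudenthal_component(3)[OF top f] x by simp
  have "x \<in> \<xi> \<VV>" if V: "\<VV> \<in> freudenthal_families X" for \<VV>
  proof -
    obtain \<WW> where W: "\<WW> \<in> freudenthal_families X" "freudenthal_le X (U0, \<U>) \<WW>" "freudenthal_le X \<VV> \<WW>"
      using freudenthal_families_directed[OF f V compactin_empty] by metis
    have "\<xi> \<WW> = {x}"
      using freudenthal_component_antimono[OF top f W(1,2)] freudenthal_component(2)[OF top W(1)]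
      unfolding x(2) by (simp add: subset_singleton_iff)
    then show ?thesis
      using freudenthal_component_antimono[OF top V W(1,3)] by simp
  qed
  then show thesis using that[OF x(1)] freudenthal_eq_embed_iff[OF top xX] by blast
qed

lemma end_notin_core:
  assumes "e \<in> ends X" "(U0, \<U>) \<in> freudenthal_families X"
  shows "e \<notin> cylinder X (U0, \<U>) U0"
proof
  assume "e \<in> cylinder X (U0, \<U>) U0"
  then obtain x where "x \<in> U0" "e = freudenthal_embed X x" using freudenthal_core[OF assms(2)] by metis
  then show False
    using assms(1) openin_subset[OF freudenthal_familiesD(3)[OF assms(2)]] unfolding ends_def by blast
qed

text \<open>A compact set containing the intersection could be swallowed by the core of a common
  refinement; the block of \<open>e\<close> there would lie in the core, which no end
  allows.\<close>

lemma end_components_unbounded: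
  assumes e: "e \<in> ends X" and f: "\<UU> \<in> freudenthal_families X" "\<VV> \<in> freudenthal_families X"
  shows "\<not> bounded_in X (e \<UU> \<inter> e \<VV>)"
proof
  assume "bounded_in X (e \<UU> \<inter> e \<VV>)"
  then obtain K where K: "compactin X K" "e \<UU> \<inter> e \<VV> \<subseteq> K" unfolding bounded_in_def by blast
  note top = end_in_topspace[OF e]
  obtain \<WW> where W: "\<WW> \<in> freudenthal_families X" "freudenthal_le X \<UU> \<WW>" "freudenthal_le X \<VV> \<WW>" "K \<subseteq> fst \<WW>"
    using freudenthal_families_directed[OF f K(1)] by metis
  obtain W0 \<W> where eq: "\<WW> = (W0, \<W>)" by (cases \<WW>)
  have "e \<WW> \<subseteq> W0"
    using freudenthal_component_antimono[OF top f(1) W(1,2)] freudenthal_component_antimono[OF top f(2) W(1,3)]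
      K(2) W(4) eq by auto
  then show False
    using end_notin_core[OF e W(1)[unfolded eq]] top eq unfolding cylinder_def by blast
qed

text \<open>A basic box of the product restricts finitely many coordinates, and the coordinate at a
  common refinement determines all of them through the bonding maps.\<close>

lemma freudenthal_base:
  assumes top: "e \<in> topspace (freudenthal X)" and Q: "openin (freudenthal X) Q" "e \<in> Q"
  obtains \<WW> where "\<WW> \<in> freudenthal_families X"
    "\<And>\<xi>. \<xi> \<in> topspace (freudenthal X) \<Longrightarrow> \<xi> \<WW> = e \<WW> \<Longrightarrow> \<xi> \<in> Q"
proof -
  let ?I = "freudenthal_families X"
  let ?Y = "\<lambda>\<UU>. quotient_topology X (freudenthal_partition X \<UU>)"
  define S where "S = {\<xi>. \<forall>i\<in>?I. \<forall>j\<in>?I. freudenthal_le X i j \<longrightarrow> freudenthal_bond X i j (\<xi> j) = \<xi> i}"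
  have F: "freudenthal X = subtopology (product_topology ?Y ?I) S"
    unfolding freudenthal_def inverse_limit_def S_def ..
  obtain T where T: "openin (product_topology ?Y ?I) T" "Q = T \<inter> S"
    using Q(1) unfolding F openin_subtopology by (elim exE conjE)
  have TQ: "T \<inter> topspace (freudenthal X) = Q"
    using openin_subset[OF T(1)] T(2) unfolding F topspace_subtopology by blast
  obtain U where U: "finite {\<UU> \<in> ?I. U \<UU> \<noteq> topspace (?Y \<UU>)}" "e \<in> Pi\<^sub>E ?I U" "Pi\<^sub>E ?I U \<subseteq> T"
    using T(1)[unfolded openin_product_topology_alt, rule_format, of e] Q(2) T(2) by auto
  have "{\<UU> \<in> ?I. U \<UU> \<noteq> topspace (?Y \<UU>)} \<subseteq> ?I" by blast
  from freudenthal_families_directed_finite[OF U(1) this]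
  obtain \<WW> where W: "\<WW> \<in> ?I" "\<forall>\<UU>\<in>{\<UU> \<in> ?I. U \<UU> \<noteq> topspace (?Y \<UU>)}. freudenthal_le X \<UU> \<WW>"
    by (elim bexE)
  show thesis
  proof (rule that[OF W(1)])
    fix \<xi> assume xi: "\<xi> \<in> topspace (freudenthal X)" "\<xi> \<WW> = e \<WW>"
    have "\<xi> \<in> Pi\<^sub>E ?I U"
    proof (rule PiE_I)
      fix \<UU> assume I: "\<UU> \<in> ?I"
      show "\<xi> \<UU> \<in> U \<UU>"
      proof (cases "U \<UU> = topspace (?Y \<UU>)")
        case True
        then show ?thesis
          using freudenthal_component(1)[OF xi(1) I]
            topspace_quotient_topology[OF partition_on_freudenthal_partition[OF I]] by simp
      next
        case False
        then have le: "freudenthal_le X \<UU> \<WW>" using W(2) I by blast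
        have "freudenthal_bond X \<UU> \<WW> (\<xi> \<WW>) = \<xi> \<UU>" "freudenthal_bond X \<UU> \<WW> (e \<WW>) = e \<UU>"
          using xi(1) top I W(1) le unfolding topspace_freudenthal by blast+
        then have "\<xi> \<UU> = e \<UU>" using xi(2) by metis
        then show ?thesis using PiE_mem[OF U(2) I] by metis
      qed
    next
      fix \<UU> assume "\<UU> \<notin> ?I"
      then show "\<xi> \<UU> = undefined" using xi(1) unfolding topspace_freudenthal
        by (metis (no_types, lifting) PiE_arb mem_Collect_eq)
    qed
    then show "\<xi> \<in> Q" using U(3) TQ xi(1) by blast
  qed
qed

text \<open>The core cylinders are open, cover everything but the ends, and have bounded traces on
  \<open>X\<close>; compactness of \<open>C\<close> reduces them to finitely many.\<close>

lemma bounded_in_if_closed_avoids_ends: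
  assumes C: "closedin (freudenthal X) C" "C \<inter> ends X = {}"
  shows "bounded_in X {x \<in> topspace X. freudenthal_embed X x \<in> C}"
proof -
  define \<S> where "\<S> = {cylinder X (U0, \<U>) U0 |U0 \<U>. (U0, \<U>) \<in> freudenthal_families X}"
  have "compactin (freudenthal X) C" using C(1) compact_space_freudenthal closedin_compact_space by blast
  moreover have "openin (freudenthal X) S" if "S \<in> \<S>" for S
    using that openin_cylinder_star[of _ _ X "{}"] unfolding \<S>_def by auto
  moreover have "C \<subseteq> \<Union>\<S>"
  proof
    fix \<xi> assume "\<xi> \<in> C"
    then have "\<xi> \<in> topspace (freudenthal X)" "\<xi> \<notin> ends X" using C closedin_subset by blast+
    then obtain x where x: "x \<in> topspace X" "\<xi> = freudenthal_embed X x"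
      unfolding ends_def by blast
    then obtain W \<W> where W: "(W, \<W>) \<in> freudenthal_families X" "{x} \<subseteq> W"
      using freudenthal_family_above_compact[of "{x}"] by auto
    have "saturated (freudenthal_partition X (W, \<W>)) W"
      using saturated_family_star[OF W(1), of W "{}"] by simp
    then have "\<xi> \<in> cylinder X (W, \<W>) W"
      using embed_in_cylinder_iff[OF W(1) x(1)] W(2) x(2) by blast
    then show "\<xi> \<in> \<Union>\<S>" using W(1) unfolding \<S>_def by blast
  qed
  ultimately obtain \<F> where F: "finite \<F>" "\<F> \<subseteq> \<S>" "C \<subseteq> \<Union>\<F>"
    using compactinD[of "freudenthal X" C \<S>] by blast
  have "\<exists>K. compactin X K \<and> {x \<in> topspace X. freudenthal_embed X x \<in> S} \<subseteq> K" if S: "S \<in> \<F>" for S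
  proof -
    obtain U0 \<U> where U: "(U0, \<U>) \<in> freudenthal_families X" "S = cylinder X (U0, \<U>) U0"
      using S F(2) unfolding \<S>_def by blast
    have sat: "saturated (freudenthal_partition X (U0, \<U>)) U0"
      using saturated_family_star[OF U(1), of U0 "{}"] by simp
    show ?thesis
      using freudenthal_familiesD(6)[OF U(1)] embed_in_cylinder_iff[OF U(1) _ sat] U(2)
      unfolding bounded_in_def by blast
  qed
  then obtain K where K: "\<And>S. S \<in> \<F> \<Longrightarrow> compactin X (K S) \<and> {x \<in> topspace X. freudenthal_embed X x \<in> S} \<subseteq> K S"
    by metis
  have "compactin X (\<Union>(K ` \<F>))" using F(1) K by (intro compactin_Union) auto
  moreover have "{x \<in> topspace X. freudenthal_embed X x \<in> C} \<subseteq> \<Union>(K ` \<F>)" using F(3) K by blast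
  ultimately show ?thesis unfolding bounded_in_def by blast
qed

end

section \<open>Metrizable spaces with a Lindelof exhaustion\<close>

text \<open>Unions of balls around a countable dense set, one radius \<open>1/(m+1)\<close> at a time, absorb every
  limit point after countably many steps; the result is clopen.\<close>

lemma metrizable_connected_Lindelof_exhaustion:
  assumes "metrizable_space X" "connected_space X" "locally_second_countable X" "Lindelof_exhaustion X \<W>"
  shows "\<exists>W\<in>\<W>. topspace X \<subseteq> W"
proof (cases "topspace X = {}")
  case True
  have "\<exists>W\<in>\<W>. \<forall>C\<in>{}. X closure_of C \<subseteq> W" using assms(4) unfolding Lindelof_exhaustion_def by blast
  then show ?thesis using True by blast
next
  case False
  then obtain a where a: "a \<in> topspace X" by blast
  obtain M d where "Metric_space M d" and X: "X = Metric_space.mtopology M d"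
    using assms(1) unfolding metrizable_space_def by metis
  then interpret Metric_space M d by simp
  have top: "topspace X = M" using X by simp
  have opW: "openin X W" and LW: "Lindelof_space (subtopology X W)" if "W \<in> \<W>" for W
    using assms(4) that unfolding Lindelof_exhaustion_def by blast+
  have cover: "topspace X = \<Union>\<W>" using assms(4) unfolding Lindelof_exhaustion_def by blast
  define \<rho> where "\<rho> m = inverse (real (Suc m))" for m
  have rho_pos: "\<rho> m > 0" for m unfolding \<rho>_def by simp
  have rho_small: "\<exists>m. 2 * \<rho> m < \<epsilon>" if "\<epsilon> > 0" for \<epsilon>
  proof -
    obtain n where "inverse (real (Suc n)) < \<epsilon> / 2"
      using reals_Archimedean[of "\<epsilon> / 2"] \<open>\<epsilon> > 0\<close> by auto
    then have "2 * \<rho> n < \<epsilon>" unfolding \<rho>_def by linarith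
    then show ?thesis by blast
  qed
  \<comment> \<open>A point \<open>y\<close> is absorbed when a ball about it reaches
    \<open>W\<close> and the ball of twice the radius lies in some member. The factor 2 lets a
    nearby centre from a dense subset of \<open>W\<close> take the place of
    \<open>y\<close>.\<close>
  define absorbs where "absorbs W W' \<longleftrightarrow> (\<forall>y m V. y \<in> M \<and> V \<in> \<W> \<and> mball y (2 * \<rho> m) \<subseteq> V \<and>
      mball y (\<rho> m) \<inter> W \<noteq> {} \<longrightarrow> y \<in> W')" for W W'
  have step: "\<exists>W'\<in>\<W>. W \<subseteq> W' \<and> absorbs W W'" if W: "W \<in> \<W>" for W
  proof -
    have Wsub: "W \<subseteq> topspace X" using opW[OF W] openin_subset by blast
    have "separable_space (subtopology X W)"
      by (rule second_countable_imp_separable_space[OF Lindelof_imp_second_countable[OF assms(3) Wsub LW[OF W]]])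
    then obtain D where D: "countable D" "subtopology X W closure_of D = W"
      unfolding separable_space_def topspace_subtopology_subset[OF Wsub] by blast
    \<comment> \<open>Only balls that already lie in a member are kept; there are countably many, so
      their union lies in a member as well.\<close>
    define I where "I = {p \<in> D \<times> UNIV. \<exists>V\<in>\<W>. mball (fst p) (\<rho> (snd p)) \<subseteq> V}"
    have cI: "countable I"
      by (rule countable_subset[of _ "D \<times> UNIV"]) (use D(1) in \<open>auto simp: I_def\<close>)
    have "\<exists>V\<in>\<W>. (\<Union>p\<in>I. mball (fst p) (\<rho> (snd p))) \<subseteq> V"
      by (rule Lindelof_exhaustion_countable_Union[OF assms(4) cI]) (simp add: I_def)
    then obtain W1 where W1: "W1 \<in> \<W>" "(\<Union>p\<in>I. mball (fst p) (\<rho> (snd p))) \<subseteq> W1" by blast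
    have "\<exists>V\<in>\<W>. (\<Union>U\<in>{W, W1}. U) \<subseteq> V"
    proof (rule Lindelof_exhaustion_countable_Union[OF assms(4)])
      show "\<exists>V\<in>\<W>. U \<subseteq> V" if "U \<in> {W, W1}" for U using that W W1(1) by blast
    qed simp
    then obtain W' where W': "W' \<in> \<W>" "W \<subseteq> W'" "W1 \<subseteq> W'" by auto
    have "absorbs W W'"
      unfolding absorbs_def
    proof (intro allI impI, elim conjE)
      fix y m V assume y: "y \<in> M" and V: "V \<in> \<W>" "mball y (2 * \<rho> m) \<subseteq> V"
        and ne: "mball y (\<rho> m) \<inter> W \<noteq> {}"
      obtain z where z: "z \<in> mball y (\<rho> m) \<inter> W" using ne by blast
      have "openin X (mball y (\<rho> m))" unfolding X by simp
      then have "openin (subtopology X W) (mball y (\<rho> m) \<inter> W)" by (rule openin_subtopology_Int)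
      moreover have "z \<in> subtopology X W closure_of D" using D(2) z by blast
      ultimately obtain x where x: "x \<in> D" "x \<in> mball y (\<rho> m)"
        using z unfolding in_closure_of by blast
      have "mball x (\<rho> m) \<subseteq> mball y (2 * \<rho> m)"
      proof
        fix w assume w: "w \<in> mball x (\<rho> m)"
        then have "w \<in> M" "x \<in> M" "d x w < \<rho> m" "d y x < \<rho> m" using x by auto
        then have "d y w < 2 * \<rho> m" using triangle[OF y \<open>x \<in> M\<close> \<open>w \<in> M\<close>] by linarith
        then show "w \<in> mball y (2 * \<rho> m)" using \<open>w \<in> M\<close> y by simp
      qed
      then have "mball x (\<rho> m) \<subseteq> V" using V(2) by blast
      then have I: "(x, m) \<in> I" unfolding I_def using x(1) V(1) by auto
      have "y \<in> mball x (\<rho> m)" using x(2) by (auto simp: commute)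
      then have "y \<in> W1" using subsetD[OF W1(2) UN_I[OF I]] by simp
      then show "y \<in> W'" using W'(3) by blast
    qed
    then show ?thesis using W' by blast
  qed
  obtain W0 where W0: "W0 \<in> \<W>" "a \<in> W0" using a cover by blast
  have "\<exists>S. \<forall>n. (S n \<in> \<W> \<and> a \<in> S n) \<and> absorbs (S n) (S (Suc n))"
  proof (rule dependent_nat_choice)
    show "\<exists>W. W \<in> \<W> \<and> a \<in> W" using W0 by blast
    show "\<exists>W'. (W' \<in> \<W> \<and> a \<in> W') \<and> absorbs W W'" if "W \<in> \<W> \<and> a \<in> W" for W and n :: nat
      using step[of W] that by blast
  qed
  then obtain S where S: "\<And>n. S n \<in> \<W>" "\<And>n. a \<in> S n" and absorb: "\<And>n. absorbs (S n) (S (Suc n))"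
    by metis
  define T where "T = (\<Union>n. S n)"
  have "openin X T" unfolding T_def using S(1) opW by blast
  moreover have "X closure_of T \<subseteq> T"
  proof
    fix y assume y: "y \<in> X closure_of T"
    then have yM: "y \<in> M" unfolding in_closure_of top by blast
    then obtain V where V: "V \<in> \<W>" "y \<in> V" using cover top by blast
    obtain \<epsilon> where e: "\<epsilon> > 0" "mball y \<epsilon> \<subseteq> V"
      using opW[OF V(1)] V(2) unfolding X openin_mtopology by blast
    \<comment> \<open>A radius this small makes \<open>y\<close> eligible for absorption: its ball
      meets some \<open>S n\<close>, hence \<open>y\<close> is in \<open>S (Suc n)\<close>.\<close>
    obtain m where m: "2 * \<rho> m < \<epsilon>" using rho_small[OF e(1)] by blast
    have sub: "mball y (2 * \<rho> m) \<subseteq> V"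
      using e(2) m mball_subset_concentric[of "2 * \<rho> m" \<epsilon> y] by auto
    have "openin X (mball y (\<rho> m))" unfolding X by simp
    moreover have "y \<in> mball y (\<rho> m)" using yM rho_pos by simp
    ultimately have "mball y (\<rho> m) \<inter> T \<noteq> {}"
      using y unfolding in_closure_of by blast
    then obtain n where "mball y (\<rho> m) \<inter> S n \<noteq> {}" unfolding T_def by blast
    then have "y \<in> S (Suc n)" using absorb[of n] yM V(1) sub unfolding absorbs_def by blast
    then show "y \<in> T" unfolding T_def by blast
  qed
  then have "closedin X T"
    using \<open>openin X T\<close> by (metis closedin_closure_of closure_of_subset openin_subset subset_antisym)
  ultimately have "T = topspace X"
    using assms(2) S(2) unfolding connected_space_clopen_in T_def by blast
  moreover have "\<exists>W\<in>\<W>. (\<Union>n\<in>UNIV. S n) \<subseteq> W"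
    using Lindelof_exhaustion_countable_Union[OF assms(4), of "UNIV :: nat set" S] S(1) by blast
  ultimately show ?thesis unfolding T_def by blast
qed

section \<open>Ends of second countable spaces\<close>

context locally_compact_Hausdorff
begin

text \<open>The family consists of finite unions of basic sets with compact closure; compactness of
  \<open>K\<close> makes one of them fit.\<close>

lemma second_countable_compact_between:
  assumes "second_countable X"
  obtains \<D> where "countable \<D>" "\<And>D. D \<in> \<D> \<Longrightarrow> openin X D" "\<And>D. D \<in> \<D> \<Longrightarrow> compactin X (X closure_of D)"
    "\<And>K Q. compactin X K \<Longrightarrow> openin X Q \<Longrightarrow> K \<subseteq> Q \<Longrightarrow> \<exists>D\<in>\<D>. K \<subseteq> D \<and> D \<subseteq> Q"
proof -
  obtain \<B> where \<B>: "countable \<B>" "\<And>V. V \<in> \<B> \<Longrightarrow> openin X V"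
    and base: "\<And>U x. openin X U \<Longrightarrow> x \<in> U \<Longrightarrow> \<exists>V\<in>\<B>. x \<in> V \<and> V \<subseteq> U"
    using assms unfolding second_countable_def by metis
  define \<D> where "\<D> = Union ` {\<F>. finite \<F> \<and> \<F> \<subseteq> {B \<in> \<B>. compactin X (X closure_of B)}}"
  show thesis
  proof
    show "countable \<D>" unfolding \<D>_def
      using countable_Collect_finite_subset[of "{B \<in> \<B>. compactin X (X closure_of B)}"] \<B>(1) by auto
    show "openin X D" if "D \<in> \<D>" for D using that \<B>(2) unfolding \<D>_def by auto
    show "compactin X (X closure_of D)" if D: "D \<in> \<D>" for D
    proof -
      obtain \<F> where F: "finite \<F>" "\<F> \<subseteq> {B \<in> \<B>. compactin X (X closure_of B)}" "D = \<Union>\<F>"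
        using D unfolding \<D>_def by blast
      have "compactin X (\<Union>B\<in>\<F>. X closure_of B)" using F(1,2) by (intro compactin_Union) auto
      then show ?thesis unfolding F(3) closure_of_Union[OF F(1)] .
    qed
    fix K Q assume K: "compactin X K" and Q: "openin X Q" "K \<subseteq> Q"
    define \<S> where "\<S> = {B \<in> \<B>. compactin X (X closure_of B) \<and> B \<subseteq> Q}"
    have "K \<subseteq> \<Union>\<S>"
    proof
      fix x assume x: "x \<in> K"
      have "compactin X {x}" using x compactin_subset_topspace[OF K] by auto
      then obtain W where W: "openin X W" "compactin X (X closure_of W)" "{x} \<subseteq> W"
        using compact_subset_regular_open by metis
      obtain B where B: "B \<in> \<B>" "x \<in> B" "B \<subseteq> W \<inter> Q"
        using base[of "W \<inter> Q" x] W Q x by blast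
      have "compactin X (X closure_of B)"
        using closed_compactin[OF W(2)] closure_of_mono[of B W X] B(3) by simp
      then show "x \<in> \<Union>\<S>" using B unfolding \<S>_def by blast
    qed
    then obtain \<F> where "finite \<F>" "\<F> \<subseteq> \<S>" "K \<subseteq> \<Union>\<F>"
      using compactinD[OF K, of \<S>] \<B>(2) unfolding \<S>_def by blast
    then have "\<Union>\<F> \<in> \<D>" "K \<subseteq> \<Union>\<F>" "\<Union>\<F> \<subseteq> Q" unfolding \<D>_def \<S>_def by blast+
    then show "\<exists>D\<in>\<D>. K \<subseteq> D \<and> D \<subseteq> Q" by blast
  qed
qed

text \<open>Modulo bounded sets, an open set with compact frontier is determined by its trace on the
  frontier of a bounded neighbourhood \<open>N\<close> of its own frontier.\<close>

definition trace_code :: "'a set \<Rightarrow> 'a set \<Rightarrow> 'a set \<Rightarrow> bool" where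
  "trace_code U N D \<longleftrightarrow> N \<noteq> {} \<and> openin X N \<and> compactin X (X closure_of N) \<and>
     X closure_of U - U \<subseteq> N \<and> D \<inter> (X closure_of N - N) = U \<inter> (X closure_of N - N)"

text \<open>\<open>U - V - N\<close> is clopen. It is not the whole space because \<open>N\<close>
  is nonempty, so connectedness leaves \<open>U - V\<close> inside \<open>N\<close>.\<close>

lemma trace_code_bounded_diff:
  assumes "connected_space X" "openin X U" "openin X V" and U: "trace_code U N D" and V: "trace_code V N D"
  shows "bounded_in X (U - V)"
proof -
  have N: "N \<noteq> {}" "openin X N" "compactin X (X closure_of N)" using U unfolding trace_code_def by blast+
  have fU: "X closure_of U - U \<subseteq> N" and fV: "X closure_of V - V \<subseteq> N"
    and tr: "U \<inter> (X closure_of N - N) = V \<inter> (X closure_of N - N)"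
    using U V unfolding trace_code_def by blast+
  have UU: "U \<subseteq> X closure_of U" and VV: "V \<subseteq> X closure_of V" and NN: "N \<subseteq> X closure_of N"
    using assms(2,3) N(2) by (simp_all add: closure_of_subset openin_subset)
  have "U - V - N = X closure_of U - (V \<union> N)" using UU fU by blast
  then have clo: "closedin X (U - V - N)" using assms(3) N(2) by (simp add: closedin_diff openin_Un)
  \<comment> \<open>For openness: a point of \<open>U\<close> on the frontier of \<open>N\<close>
    lies in \<open>V\<close> by the equal traces, and the frontier of \<open>V\<close> lies in
    \<open>N\<close>.\<close>
  have "U - V - N = U - (X closure_of V \<union> X closure_of N)" using VV NN fV tr by blast
  then have "openin X (U - V - N)" using assms(2) by (simp add: closedin_Un openin_diff)
  then have "U - V - N = {} \<or> U - V - N = topspace X"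
    using clo assms(1) unfolding connected_space_clopen_in by blast
  moreover have "N \<subseteq> topspace X" using N(2) by (rule openin_subset)
  ultimately have "U - V \<subseteq> N" using N(1) by blast
  then show ?thesis unfolding bounded_in_def using N(3) NN by blast
qed

text \<open>The frontier of \<open>U\<close> misses that of \<open>N\<close>, so the trace of
  \<open>U\<close> there is compact, and some \<open>D\<close> of a countable family fits between
  the trace and \<open>U\<close>.\<close>

lemma countable_trace_codes:
  assumes "second_countable X" "topspace X \<noteq> {}"
  obtains \<D> where "countable \<D>"
    "\<And>U. openin X U \<Longrightarrow> compactin X (X closure_of U - U) \<Longrightarrow> \<exists>N\<in>\<D>. \<exists>D\<in>\<D>. trace_code U N D"
proof -
  obtain \<D> where \<D>: "countable \<D>" "\<And>D. D \<in> \<D> \<Longrightarrow> openin X D" "\<And>D. D \<in> \<D> \<Longrightarrow> compactin X (X closure_of D)"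
    and between: "\<And>K Q. compactin X K \<Longrightarrow> openin X Q \<Longrightarrow> K \<subseteq> Q \<Longrightarrow> \<exists>D\<in>\<D>. K \<subseteq> D \<and> D \<subseteq> Q"
    using second_countable_compact_between[OF assms(1)] by metis
  obtain a where a: "a \<in> topspace X" using assms(2) by blast
  have "\<exists>N\<in>\<D>. \<exists>D\<in>\<D>. trace_code U N D" if U: "openin X U" "compactin X (X closure_of U - U)" for U
  proof -
    \<comment> \<open>The extra point \<open>a\<close> forces \<open>N\<close> to be nonempty even
      when the frontier of \<open>U\<close> is empty.\<close>
    have co: "compactin X (insert a (X closure_of U - U))"
      using compactin_Un[OF _ U(2), of "{a}"] a by simp
    obtain N where N: "N \<in> \<D>" "insert a (X closure_of U - U) \<subseteq> N"
      using between[OF co openin_topspace compactin_subset_topspace[OF co]] by blast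
    have UU: "U \<subseteq> X closure_of U" using U(1) by (simp add: closure_of_subset openin_subset)
    have "U \<inter> (X closure_of N - N) = X closure_of U \<inter> (X closure_of N - N)" using N(2) UU by blast
    moreover have "closedin X (X closure_of U \<inter> (X closure_of N - N))"
      using \<D>(2)[OF N(1)] by (simp add: closedin_Int closedin_diff)
    ultimately have "compactin X (U \<inter> (X closure_of N - N))"
      using closed_compactin[OF \<D>(3)[OF N(1)], of "U \<inter> (X closure_of N - N)"] by auto
    then obtain D where "D \<in> \<D>" "U \<inter> (X closure_of N - N) \<subseteq> D" "D \<subseteq> U"
      using between[OF _ U(1)] by blast
    then have "trace_code U N D" unfolding trace_code_def using N \<D>(2,3)[OF N(1)] by blast
    then show ?thesis using N(1) \<open>D \<in> \<D>\<close> by blast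
  qed
  then show thesis using that \<D>(1) by blast
qed

text \<open>The part of the end space on the side of the outer member \<open>U\<close>; these sets
  form a base of the end space.\<close>

definition end_fibre :: "'a pointed_family \<Rightarrow> 'a set \<Rightarrow> ('a pointed_family \<Rightarrow> 'a set) set" where
  "end_fibre \<UU> U = {e \<in> ends X. e \<UU> = X closure_of U}"

lemma openin_end_fibre:
  assumes f: "(U0, \<U>) \<in> freudenthal_families X" and "U \<in> \<U>"
  shows "openin (end_space X) (end_fibre (U0, \<U>) U)"
proof -
  have "e (U0, \<U>) = X closure_of U \<longleftrightarrow> e \<in> cylinder X (U0, \<U>) (U0 \<union> (\<Union>V\<in>{U}. X closure_of V))"
    if e: "e \<in> ends X" for e
  proof -
    obtain V where V: "V \<in> \<U>" "e (U0, \<U>) = X closure_of V"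
      by (rule end_component[OF end_in_topspace[OF e] f end_notin_core[OF e f]])
    have ne: "X closure_of V \<noteq> {}"
      using freudenthal_component(2)[OF end_in_topspace[OF e] f] V(2) by simp
    note D = freudenthal_familiesD(10,11)[OF f]
    show ?thesis
      using D(1)[OF V(1)] D(2)[OF V(1) assms(2)] ne V end_in_topspace[OF e] unfolding cylinder_def by auto
  qed
  then have "end_fibre (U0, \<U>) U = ends X \<inter> cylinder X (U0, \<U>) (U0 \<union> (\<Union>V\<in>{U}. X closure_of V))"
    unfolding end_fibre_def by blast
  then show ?thesis
    unfolding end_space_def openin_subtopology
    using openin_cylinder_star[OF f, of "{U}"] assms(2) by (metis Int_commute empty_subsetI insert_subset)
qed

lemma end_fibre_base:
  assumes "e \<in> ends X" "openin (freudenthal X) Q" "e \<in> Q"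
  obtains U0 \<U> U where "(U0, \<U>) \<in> freudenthal_families X" "U \<in> \<U>" "e \<in> end_fibre (U0, \<U>) U"
    "end_fibre (U0, \<U>) U \<subseteq> Q"
proof -
  obtain \<WW> where W: "\<WW> \<in> freudenthal_families X"
    "\<And>\<xi>. \<xi> \<in> topspace (freudenthal X) \<Longrightarrow> \<xi> \<WW> = e \<WW> \<Longrightarrow> \<xi> \<in> Q"
    using freudenthal_base[OF end_in_topspace[OF assms(1)] assms(2,3)] by metis
  obtain U0 \<U> where eq: "\<WW> = (U0, \<U>)" by (cases \<WW>)
  obtain U where U: "U \<in> \<U>" "e (U0, \<U>) = X closure_of U"
    by (rule end_component[OF end_in_topspace[OF assms(1)] W(1)[unfolded eq] end_notin_core[OF assms(1) W(1)[unfolded eq]]])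
  show thesis
  proof (rule that[OF W(1)[unfolded eq] U(1)])
    show "e \<in> end_fibre (U0, \<U>) U" using assms(1) U(2) unfolding end_fibre_def by blast
    show "end_fibre (U0, \<U>) U \<subseteq> Q"
      using W(2) U(2) end_in_topspace unfolding end_fibre_def eq by fastforce
  qed
qed

text \<open>If the second family placed the end in some \<open>S\<close> other than
  \<open>V\<close>, then \<open>S\<close> and \<open>V\<close> would be disjoint, and the closures
  of \<open>U\<close> and \<open>S\<close> would meet only in \<open>U - V\<close> and two
  frontiers, a bounded set.\<close>

lemma end_fibre_mono_mod_bounded:
  assumes U: "(U0, \<U>) \<in> freudenthal_families X" "U \<in> \<U>"
    and V: "(V0, \<V>) \<in> freudenthal_families X" "V \<in> \<V>"
    and "bounded_in X (U - V)"
  shows "end_fibre (U0, \<U>) U \<subseteq> end_fibre (V0, \<V>) V"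
proof
  fix e assume "e \<in> end_fibre (U0, \<U>) U"
  then have e: "e \<in> ends X" "e (U0, \<U>) = X closure_of U" unfolding end_fibre_def by auto
  obtain S where S: "S \<in> \<V>" "e (V0, \<V>) = X closure_of S"
    by (rule end_component[OF end_in_topspace[OF e(1)] V(1) end_notin_core[OF e(1) V(1)]])
  have "S = V"
  proof (rule ccontr)
    assume "S \<noteq> V"
    then have "S \<inter> V = {}" using freudenthal_familiesD(5)[OF V(1) S(1) V(2)] by blast
    obtain K where K: "compactin X K" "U - V \<subseteq> K" using assms(5) unfolding bounded_in_def by blast
    let ?L = "K \<union> ((X closure_of U - U) \<union> (X closure_of S - S))"
    have "compactin X ?L"
      using K(1) freudenthal_familiesD(8)[OF U] freudenthal_familiesD(8)[OF V(1) S(1)] by (intro compactin_Un)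
    moreover have "X closure_of U \<inter> X closure_of S \<subseteq> ?L" using K(2) \<open>S \<inter> V = {}\<close> by blast
    ultimately have "bounded_in X (e (U0, \<U>) \<inter> e (V0, \<V>))"
      unfolding bounded_in_def e(2) S(2) by blast
    then show False using end_components_unbounded[OF e(1) U(1) V(1)] by blast
  qed
  then show "e \<in> end_fibre (V0, \<V>) V" using e(1) S(2) unfolding end_fibre_def by simp
qed

text \<open>Two outer members with the same trace code differ by bounded sets in both directions, so
  they have the same fibre. Hence there are no more fibres than codes.\<close>

lemma second_countable_end_space:
  assumes "second_countable X" "connected_space X"
  shows "second_countable (end_space X)"
proof (cases "topspace X = {}")
  case True
  have "ends X = {}"
  proof (rule ccontr)
    assume "ends X \<noteq> {}"
    then obtain e where e: "e \<in> ends X" by blast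
    obtain W \<W> where "(W, \<W>) \<in> freudenthal_families X"
      using freudenthal_family_above_compact[OF compactin_empty] by metis
    then show False using freudenthal_component(2,3)[OF end_in_topspace[OF e]] True by blast
  qed
  then have "\<not> (openin (end_space X) S \<and> e \<in> S)" for S e
    using openin_subset topspace_end_space by (metis empty_iff subset_empty)
  then show ?thesis unfolding second_countable_def by (intro exI[of _ "{}"]) simp
next
  case False
  define \<G> where "\<G> = {end_fibre (U0, \<U>) U |U0 \<U> U. (U0, \<U>) \<in> freudenthal_families X \<and> U \<in> \<U>}"
  obtain \<D> where \<D>: "countable \<D>"
    and code: "\<And>U. openin X U \<Longrightarrow> compactin X (X closure_of U - U) \<Longrightarrow> \<exists>N\<in>\<D>. \<exists>D\<in>\<D>. trace_code U N D"
    using countable_trace_codes[OF assms(1) False] by metis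
  define P where "P G c \<longleftrightarrow> c \<in> \<D> \<times> \<D> \<and> (\<exists>U0 \<U> U. (U0, \<U>) \<in> freudenthal_families X \<and> U \<in> \<U> \<and>
      G = end_fibre (U0, \<U>) U \<and> trace_code U (fst c) (snd c))" for G c
  have "\<exists>c. P G c" if "G \<in> \<G>" for G
  proof -
    obtain U0 \<U> U where U: "(U0, \<U>) \<in> freudenthal_families X" "U \<in> \<U>" "G = end_fibre (U0, \<U>) U"
      using \<open>G \<in> \<G>\<close> unfolding \<G>_def by blast
    obtain N D where "N \<in> \<D>" "D \<in> \<D>" "trace_code U N D"
      using code[OF freudenthal_familiesD(4,8)[OF U(1,2)]] by blast
    then have "P G (N, D)" unfolding P_def using U by auto
    then show ?thesis by blast
  qed
  then obtain c where c: "\<And>G. G \<in> \<G> \<Longrightarrow> P G (c G)" by metis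
  have sub: "G \<subseteq> H" if PP: "P G k" "P H k" for G H k
  proof -
    obtain U0 \<U> U where U: "(U0, \<U>) \<in> freudenthal_families X" "U \<in> \<U>" "G = end_fibre (U0, \<U>) U"
      "trace_code U (fst k) (snd k)"
      using PP(1) unfolding P_def by blast
    obtain V0 \<V> V where V: "(V0, \<V>) \<in> freudenthal_families X" "V \<in> \<V>" "H = end_fibre (V0, \<V>) V"
      "trace_code V (fst k) (snd k)"
      using PP(2) unfolding P_def by blast
    show ?thesis
      unfolding U(3) V(3)
      by (intro end_fibre_mono_mod_bounded U V trace_code_bounded_diff[OF assms(2) _ _ U(4) V(4)]
          freudenthal_familiesD(4)[OF U(1,2)] freudenthal_familiesD(4)[OF V(1,2)])
  qed
  have "inj_on c \<G>"
    using sub c by (metis inj_onI subset_antisym)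
  moreover have "c ` \<G> \<subseteq> \<D> \<times> \<D>" using c unfolding P_def by blast
  ultimately have "countable \<G>"
    using \<D> by (meson countable_SIGMA countable_image_inj_on countable_subset)
  moreover have "openin (end_space X) G" if "G \<in> \<G>" for G
    using that openin_end_fibre unfolding \<G>_def by blast
  moreover have "\<exists>G\<in>\<G>. e \<in> G \<and> G \<subseteq> S" if S: "openin (end_space X) S" "e \<in> S" for S e
  proof -
    obtain Q where Q: "openin (freudenthal X) Q" "S = Q \<inter> ends X"
      using S(1) unfolding end_space_def openin_subtopology by blast
    obtain U0 \<U> U where "(U0, \<U>) \<in> freudenthal_families X" "U \<in> \<U>" "e \<in> end_fibre (U0, \<U>) U"
      "end_fibre (U0, \<U>) U \<subseteq> Q"
      using end_fibre_base[of e Q] Q S(2) by blast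
    moreover have "end_fibre (U0, \<U>) U \<subseteq> ends X" unfolding end_fibre_def by blast
    ultimately show ?thesis unfolding Q(2) \<G>_def by blast
  qed
  ultimately show ?thesis unfolding second_countable_def by blast
qed

text \<open>The closure of a relatively compact \<open>N\<close> is put into a core
  \<open>V0\<close>. Removing it from the union of \<open>V0\<close> and the outer block of
  \<open>e\<close> leaves an open saturated set that misses \<open>N\<close>.\<close>

lemma end_avoids_neighbourhood:
  assumes e: "e \<in> ends X" and x: "x \<in> topspace X"
  obtains N Q where "openin X N" "x \<in> N" "openin (freudenthal X) Q" "e \<in> Q"
    "\<And>y. y \<in> N \<Longrightarrow> freudenthal_embed X y \<notin> Q"
proof -
  have "compactin X {x}" using x by simp
  then obtain N where N: "openin X N" "compactin X (X closure_of N)" "x \<in> N"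
    using compact_subset_regular_open[of "{x}"] by auto
  obtain V0 \<V> where f: "(V0, \<V>) \<in> freudenthal_families X" "X closure_of N \<subseteq> V0"
    by (rule freudenthal_family_above_compact[OF N(2)])
  obtain V where V: "V \<in> \<V>" "e (V0, \<V>) = X closure_of V"
    by (rule end_component[OF end_in_topspace[OF e] f(1) end_notin_core[OF e f(1)]])
  let ?Q = "(V0 - X closure_of N) \<union> (\<Union>V\<in>{V}. X closure_of V)"
  have disj: "V0 \<inter> X closure_of V = {}" by (rule freudenthal_familiesD(10)[OF f(1) V(1)])
  have sat: "saturated (freudenthal_partition X (V0, \<V>)) ?Q"
    using saturated_family_star[OF f(1), of "V0 - X closure_of N" "{V}"] V(1) by blast
  have "openin X (V0 \<union> (\<Union>V\<in>{V}. X closure_of V))"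
    using openin_family_star[OF f(1), of "{V}"] V(1) by blast
  moreover have "?Q = V0 \<union> (\<Union>V\<in>{V}. X closure_of V) - X closure_of N" using disj f(2) by auto
  ultimately have op: "openin X ?Q" by (simp add: openin_diff)
  show thesis
  proof (rule that[OF N(1,3) openin_cylinder[OF f(1) op sat]])
    show "e \<in> cylinder X (V0, \<V>) ?Q" using V(2) end_in_topspace[OF e] unfolding cylinder_def by simp
    fix y assume y: "y \<in> N"
    have yX: "y \<in> topspace X" using y openin_subset[OF N(1)] by blast
    have "y \<in> X closure_of N" using y closure_of_subset[OF openin_subset[OF N(1)]] by blast
    then have "y \<notin> ?Q" using f(2) disj by auto
    then show "freudenthal_embed X y \<notin> cylinder X (V0, \<V>) ?Q"
      using embed_in_cylinder_iff[OF f(1) yX sat] by simp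
  qed
qed

lemma ends_distinguished:
  assumes "e \<in> ends X" "e' \<in> ends X" "e \<noteq> e'"
  obtains G where "openin (end_space X) G" "e \<in> G" "e' \<notin> G"
proof -
  have "\<exists>\<UU>\<in>freudenthal_families X. e \<UU> \<noteq> e' \<UU>"
  proof (rule ccontr)
    assume "\<not> ?thesis"
    moreover have "e \<in> extensional (freudenthal_families X)" "e' \<in> extensional (freudenthal_families X)"
      using assms(1,2)[THEN end_in_topspace] unfolding topspace_freudenthal PiE_def by blast+
    ultimately have "e = e'" by (metis extensionalityI)
    then show False using assms(3) by blast
  qed
  then obtain U0 \<U> where f: "(U0, \<U>) \<in> freudenthal_families X" "e (U0, \<U>) \<noteq> e' (U0, \<U>)" by auto
  obtain U where U: "U \<in> \<U>" "e (U0, \<U>) = X closure_of U"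
    by (rule end_component[OF end_in_topspace[OF assms(1)] f(1) end_notin_core[OF assms(1) f(1)]])
  show thesis
    using that[OF openin_end_fibre[OF f(1) U(1)]] U(2) f(2) assms(1) unfolding end_fibre_def by auto
qed

text \<open>Two countable collections isolate \<open>e\<close>: by the Lindelof property countably
  many neighbourhoods of \<open>e\<close> exclude all points of \<open>X\<close>, and extensions of
  basic sets of the end space exclude the other ends.\<close>

lemma short_end_if_second_countable:
  assumes "second_countable X" "second_countable (end_space X)" "e \<in> ends X"
  shows "short_end X e"
proof -
  obtain \<B> where \<B>: "countable \<B>" "\<And>B. B \<in> \<B> \<Longrightarrow> openin (end_space X) B"
    and base: "\<And>U x. openin (end_space X) U \<Longrightarrow> x \<in> U \<Longrightarrow> \<exists>B\<in>\<B>. x \<in> B \<and> B \<subseteq> U"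
    using assms(2) unfolding second_countable_def by metis
  have "\<exists>Q. openin (freudenthal X) Q \<and> B = Q \<inter> ends X" if "B \<in> \<B>" for B
    using \<B>(2)[OF that] unfolding end_space_def openin_subtopology by blast
  then obtain q where q: "\<And>B. B \<in> \<B> \<Longrightarrow> openin (freudenthal X) (q B) \<and> B = q B \<inter> ends X" by metis
  have "\<exists>N Q. openin X N \<and> x \<in> N \<and> openin (freudenthal X) Q \<and> e \<in> Q \<and> (\<forall>y\<in>N. freudenthal_embed X y \<notin> Q)"
    if x: "x \<in> topspace X" for x
    by (rule end_avoids_neighbourhood[OF assms(3) x]) blast
  then obtain N Q where NQ: "\<And>x. x \<in> topspace X \<Longrightarrow> openin X (N x) \<and> x \<in> N x \<and> openin (freudenthal X) (Q x)
      \<and> e \<in> Q x \<and> (\<forall>y\<in>N x. freudenthal_embed X y \<notin> Q x)"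
    by metis
  have "\<exists>\<V>. countable \<V> \<and> \<V> \<subseteq> N ` topspace X \<and> \<Union>\<V> = topspace X"
  proof (rule Lindelof_spaceD[OF second_countable_imp_Lindelof_space[OF assms(1)]])
    show "openin X U" if "U \<in> N ` topspace X" for U using that NQ by blast
    have "N x \<subseteq> topspace X" if "x \<in> topspace X" for x using NQ[OF that] openin_subset by blast
    then show "\<Union>(N ` topspace X) = topspace X" using NQ by blast
  qed
  then obtain A where A: "countable A" "A \<subseteq> topspace X" "(\<Union>x\<in>A. N x) = topspace X"
    by (metis countable_subset_image)
  \<comment> \<open>The whole space is included so that the intersection never leaves the
    compactification.\<close>
  define \<S> where "\<S> = insert (topspace (freudenthal X)) (Q ` A \<union> q ` {B \<in> \<B>. e \<in> B})"
  have "countable \<S>" unfolding \<S>_def using A(1) \<B>(1) by simp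
  moreover have "\<S> \<subseteq> Collect (openin (freudenthal X))"
    unfolding \<S>_def using NQ A(2) q by blast
  moreover have "\<Inter>\<S> = {e}"
  proof
    have "e \<in> q B" if "B \<in> \<B>" "e \<in> B" for B using q[OF that(1)] that(2) by blast
    then show "{e} \<subseteq> \<Inter>\<S>" unfolding \<S>_def using NQ A(2) end_in_topspace[OF assms(3)] by blast
    show "\<Inter>\<S> \<subseteq> {e}"
    proof
      fix \<xi> assume xi: "\<xi> \<in> \<Inter>\<S>"
      have "\<xi> \<in> ends X"
      proof (rule ccontr)
        assume "\<xi> \<notin> ends X"
        moreover have "\<xi> \<in> topspace (freudenthal X)" using xi unfolding \<S>_def by blast
        ultimately obtain y where y: "y \<in> topspace X" "\<xi> = freudenthal_embed X y" unfolding ends_def by blast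
        then obtain x where x: "x \<in> A" "y \<in> N x" using A(3) by blast
        then have "\<xi> \<notin> Q x" using NQ A(2) y(2) by blast
        then show False using xi x(1) unfolding \<S>_def by blast
      qed
      have "\<xi> = e"
      proof (rule ccontr)
        assume "\<xi> \<noteq> e"
        then obtain G where G: "openin (end_space X) G" "e \<in> G" "\<xi> \<notin> G"
          using ends_distinguished[OF assms(3) \<open>\<xi> \<in> ends X\<close>] by metis
        obtain B where B: "B \<in> \<B>" "e \<in> B" "B \<subseteq> G" using base[OF G(1,2)] by blast
        then have "\<xi> \<in> q B" using xi unfolding \<S>_def by blast
        then show False using q[OF B(1)] \<open>\<xi> \<in> ends X\<close> B(3) G(3) by blast
      qed
      then show "\<xi> \<in> {e}" by simp
    qed
  qed
  ultimately have "(countable intersection_of openin (freudenthal X)) {e}"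
    unfolding intersection_of_def by blast
  then show ?thesis
    unfolding short_end_def gdelta_in_alt using assms(3) end_in_topspace by blast
qed

section \<open>Spaces with second countable end space and short ends\<close>

text \<open>Pairs are recorded instead of sets of ends, because the frontier of the open set
  \<open>U\<close> must remain accessible. Neighbourhoods are taken in the compactification, ready
  for the open sets that witness shortness.\<close>

definition end_base :: "('a pointed_family \<times> 'a set) set \<Rightarrow> bool" where
  "end_base \<K> \<longleftrightarrow> (\<forall>f U. (f, U) \<in> \<K> \<longrightarrow> f \<in> freudenthal_families X \<and> U \<in> snd f) \<and>
     (\<forall>e\<in>ends X. \<forall>Q. openin (freudenthal X) Q \<and> e \<in> Q \<longrightarrow>
        (\<exists>f U. (f, U) \<in> \<K> \<and> e \<in> end_fibre f U \<and> end_fibre f U \<subseteq> Q))"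

text \<open>Fibres form a base, but a countable part has to be extracted: for each pair of sets of a
  countable base, one fibre between them is chosen whenever there is one.\<close>

lemma countable_end_base:
  assumes "second_countable (end_space X)"
  shows "\<exists>\<K>. countable \<K> \<and> end_base \<K>"
proof -
  obtain \<B> where \<B>: "countable \<B>" "\<And>B. B \<in> \<B> \<Longrightarrow> openin (end_space X) B"
    and base: "\<And>U x. openin (end_space X) U \<Longrightarrow> x \<in> U \<Longrightarrow> \<exists>B\<in>\<B>. x \<in> B \<and> B \<subseteq> U"
    using assms unfolding second_countable_def by metis
  define P where "P b k \<longleftrightarrow> fst k \<in> freudenthal_families X \<and> snd k \<in> snd (fst k) \<and>
      fst b \<subseteq> end_fibre (fst k) (snd k) \<and> end_fibre (fst k) (snd k) \<subseteq> snd b" for b k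
  define G where "G = {b \<in> \<B> \<times> \<B>. \<exists>k. P b k}"
  have "\<exists>k. P b k" if "b \<in> G" for b using that unfolding G_def by blast
  then obtain c where c: "\<And>b. b \<in> G \<Longrightarrow> P b (c b)" by metis
  have "countable G" by (rule countable_subset[of _ "\<B> \<times> \<B>"]) (auto simp: G_def \<B>(1))
  then have "countable (c ` G)" by simp
  moreover have "end_base (c ` G)"
    unfolding end_base_def
  proof (intro conjI allI ballI impI; (elim conjE)?)
    have fam: "f \<in> freudenthal_families X \<and> U \<in> snd f" if fU: "(f, U) \<in> c ` G" for f U
    proof -
      obtain b where "b \<in> G" "c b = (f, U)" using fU by auto
      then show ?thesis using c[of b] unfolding P_def by simp
    qed
    then show "(f, U) \<in> c ` G \<Longrightarrow> f \<in> freudenthal_families X" "(f, U) \<in> c ` G \<Longrightarrow> U \<in> snd f" for f U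
      by auto
    fix e Q assume e: "e \<in> ends X" and Q: "openin (freudenthal X) Q" "e \<in> Q"
    have "openin (end_space X) (Q \<inter> ends X)"
      unfolding end_space_def using Q(1) by (rule openin_subtopology_Int)
    then obtain B' where B': "B' \<in> \<B>" "e \<in> B'" "B' \<subseteq> Q \<inter> ends X" using base e Q(2) by blast
    obtain Q' where Q': "openin (freudenthal X) Q'" "B' = Q' \<inter> ends X"
      using \<B>(2)[OF B'(1)] unfolding end_space_def openin_subtopology by blast
    have "e \<in> Q'" using B'(2) Q'(2) by blast
    obtain U0 \<U> U where U: "(U0, \<U>) \<in> freudenthal_families X" "U \<in> \<U>" "e \<in> end_fibre (U0, \<U>) U"
      "end_fibre (U0, \<U>) U \<subseteq> Q'"
      by (rule end_fibre_base[OF e Q'(1) \<open>e \<in> Q'\<close>])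
    obtain B where B: "B \<in> \<B>" "e \<in> B" "B \<subseteq> end_fibre (U0, \<U>) U"
      using base[OF openin_end_fibre[OF U(1,2)] U(3)] by blast
    have "end_fibre (U0, \<U>) U \<subseteq> B'" using U(4) Q'(2) unfolding end_fibre_def by blast
    then have "P (B, B') ((U0, \<U>), U)" unfolding P_def using U B by simp
    then have "(B, B') \<in> G" unfolding G_def using B B' by blast
    then have "P (B, B') (c (B, B'))" "c (B, B') \<in> c ` G" using c by auto
    moreover obtain f V where fV: "c (B, B') = (f, V)" by (metis surj_pair)
    ultimately have "(f, V) \<in> c ` G" "B \<subseteq> end_fibre f V" "end_fibre f V \<subseteq> B'" unfolding P_def by auto
    then show "\<exists>f U. (f, U) \<in> c ` G \<and> e \<in> end_fibre f U \<and> end_fibre f U \<subseteq> Q"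
      using B(2) B'(3) by (intro exI[of _ f] exI[of _ V]) auto
  qed
  ultimately show ?thesis by blast
qed

text \<open>If the open sets whose trace on \<open>C\<close> lies in a member covered everything,
  finitely many would, and \<open>C\<close> would lie in a member. A point left uncovered is an end,
  since points of \<open>X\<close> have bounded core neighbourhoods.\<close>

lemma freudenthal_cluster_point:
  assumes "Lindelof_exhaustion X \<W>" "C \<subseteq> topspace X" "\<not> (\<exists>W\<in>\<W>. C \<subseteq> W)"
  shows "\<exists>e\<in>ends X. \<forall>Q. openin (freudenthal X) Q \<and> e \<in> Q \<longrightarrow>
      \<not> (\<exists>W\<in>\<W>. {x \<in> C. freudenthal_embed X x \<in> Q} \<subseteq> W)"
proof -
  define \<S> where "\<S> = {Q. openin (freudenthal X) Q \<and> (\<exists>W\<in>\<W>. {x \<in> C. freudenthal_embed X x \<in> Q} \<subseteq> W)}"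
  have "\<not> topspace (freudenthal X) \<subseteq> \<Union>\<S>"
  proof
    assume "topspace (freudenthal X) \<subseteq> \<Union>\<S>"
    moreover have "\<And>Q. Q \<in> \<S> \<Longrightarrow> openin (freudenthal X) Q" unfolding \<S>_def by blast
    ultimately obtain \<F> where F: "finite \<F>" "\<F> \<subseteq> \<S>" "topspace (freudenthal X) \<subseteq> \<Union>\<F>"
      using compact_space_freudenthal compactinD unfolding compact_space_def by metis
    have "\<exists>W\<in>\<W>. (\<Union>Q\<in>\<F>. {x \<in> C. freudenthal_embed X x \<in> Q}) \<subseteq> W"
      using F(2) unfolding \<S>_def
      by (intro Lindelof_exhaustion_countable_Union[OF assms(1) countable_finite[OF F(1)]]) blast
    moreover have "C \<subseteq> (\<Union>Q\<in>\<F>. {x \<in> C. freudenthal_embed X x \<in> Q})"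
    proof
      fix x assume x: "x \<in> C"
      have "freudenthal_embed X x \<in> \<Union>\<F>"
        by (rule subsetD[OF F(3) freudenthal_embed_in_topspace[OF subsetD[OF assms(2) x]]])
      then show "x \<in> (\<Union>Q\<in>\<F>. {x \<in> C. freudenthal_embed X x \<in> Q})" using x by blast
    qed
    ultimately show False using assms(3) by (meson order_trans)
  qed
  then obtain e where e: "e \<in> topspace (freudenthal X)" "e \<notin> \<Union>\<S>" by blast
  have "e \<in> ends X"
  proof (rule ccontr)
    assume "e \<notin> ends X"
    then obtain x where x: "x \<in> topspace X" "e = freudenthal_embed X x" using e(1) unfolding ends_def by blast
    then have "compactin X {x}" by simp
    then obtain W \<F> where f: "(W, \<F>) \<in> freudenthal_families X" "{x} \<subseteq> W"
      by (rule freudenthal_family_above_compact)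
    have sat: "saturated (freudenthal_partition X (W, \<F>)) W"
      using saturated_family_star[OF f(1), of W "{}"] by simp
    have op: "openin (freudenthal X) (cylinder X (W, \<F>) W)"
      by (rule openin_cylinder[OF f(1) freudenthal_familiesD(3)[OF f(1)] sat])
    have "{x \<in> C. freudenthal_embed X x \<in> cylinder X (W, \<F>) W} \<subseteq> W"
      using embed_in_cylinder_iff[OF f(1) _ sat] assms(2) by blast
    moreover obtain V where "V \<in> \<W>" "W \<subseteq> V"
      using Lindelof_exhaustion_bounded_in[OF assms(1) freudenthal_familiesD(6)[OF f(1)]] by blast
    ultimately have "cylinder X (W, \<F>) W \<in> \<S>" unfolding \<S>_def using op by blast
    moreover have "e \<in> cylinder X (W, \<F>) W"
      using embed_in_cylinder_iff[OF f(1) x(1) sat] f(2) x(2) by blast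
    ultimately show False using e(2) by blast
  qed
  moreover have "\<not> (\<exists>W\<in>\<W>. {x \<in> C. freudenthal_embed X x \<in> Q} \<subseteq> W)"
    if "openin (freudenthal X) Q" "e \<in> Q" for Q
    using e(2) that unfolding \<S>_def by blast
  ultimately show ?thesis by (intro bexI[of _ e]) auto
qed

text \<open>A connected set avoiding the frontiers of a countable base at the ends either lies in or misses
  each basic neighbourhood of a cluster end \<open>e\<close>; as \<open>e\<close> is a \<open>G\<^sub>\<delta>\<close> point, it is a countable union of bounded sets.\<close>

lemma connected_avoiding_frontiers_small:
  assumes ex: "Lindelof_exhaustion X \<W>" and short: "\<forall>e\<in>ends X. short_end X e"
    and base: "end_base \<K>"
    and C: "connectedin X C" and avoid: "\<And>f U. (f, U) \<in> \<K> \<Longrightarrow> C \<inter> (X closure_of U - U) = {}"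
  shows "\<exists>W\<in>\<W>. C \<subseteq> W"
proof (rule ccontr)
  assume not: "\<not> (\<exists>W\<in>\<W>. C \<subseteq> W)"
  have CX: "C \<subseteq> topspace X" using C connectedin_subset_topspace by blast
  obtain e where e: "e \<in> ends X"
    and large: "\<forall>Q. openin (freudenthal X) Q \<and> e \<in> Q \<longrightarrow> \<not> (\<exists>W\<in>\<W>. {x \<in> C. freudenthal_embed X x \<in> Q} \<subseteq> W)"
    using freudenthal_cluster_point[OF ex CX not] by (elim bexE)
  have "short_end X e" using short e by (rule bspec)
  then have "(countable intersection_of openin (freudenthal X)) {e}"
    unfolding short_end_def gdelta_in_alt by (elim conjE)
  then obtain \<S> where S: "countable \<S>" "\<S> \<subseteq> Collect (openin (freudenthal X))" "\<Inter>\<S> = {e}"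
    unfolding intersection_of_def by blast
  \<comment> \<open>The sets of \<open>\<S>\<close> meet only in \<open>e\<close>, so
    \<open>C\<close> is the union of its parts outside them; each such part turns out to be
    bounded.\<close>
  have small: "\<exists>W\<in>\<W>. {x \<in> C. freudenthal_embed X x \<notin> Q} \<subseteq> W" if "Q \<in> \<S>" for Q
  proof -
    have Q: "openin (freudenthal X) Q" "e \<in> Q" using S(2,3) \<open>Q \<in> \<S>\<close> by blast+
    obtain f U where fU: "(f, U) \<in> \<K>" "e \<in> end_fibre f U" "end_fibre f U \<subseteq> Q"
      using base e Q unfolding end_base_def by metis
    obtain U0 \<U> where eq: "f = (U0, \<U>)" by (cases f)
    have f: "(U0, \<U>) \<in> freudenthal_families X" and U: "U \<in> \<U>"
      using base fU(1) unfolding end_base_def eq by auto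
    note D = freudenthal_familiesD[OF f]
    let ?R = "U0 \<union> (\<Union>V\<in>{U}. X closure_of V)"
    have sat: "saturated (freudenthal_partition X (U0, \<U>)) ?R"
      using saturated_family_star[OF f order_refl, of "{U}"] U by blast
    have op: "openin (freudenthal X) (cylinder X (U0, \<U>) ?R)"
      using openin_cylinder_star[OF f, of "{U}"] U by blast
    have "e \<in> cylinder X (U0, \<U>) ?R"
      using fU(2) end_in_topspace[OF e] unfolding eq end_fibre_def cylinder_def by auto
    then have L: "\<not> (\<exists>W\<in>\<W>. {x \<in> C. freudenthal_embed X x \<in> cylinder X (U0, \<U>) ?R} \<subseteq> W)"
      using large op by blast
    have "freudenthal_embed X x \<in> cylinder X (U0, \<U>) ?R \<longleftrightarrow> x \<in> ?R" if "x \<in> C" for x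
      by (rule embed_in_cylinder_iff[OF f subsetD[OF CX that] sat])
    then have R: "{x \<in> C. freudenthal_embed X x \<in> cylinder X (U0, \<U>) ?R} = C \<inter> ?R" by blast
    \<comment> \<open>The core is bounded, so a part of \<open>C\<close> that fits into no member
      cannot stay in it; hence \<open>C\<close> reaches \<open>U\<close>.\<close>
    obtain W where "W \<in> \<W>" "U0 \<subseteq> W" using Lindelof_exhaustion_bounded_in[OF ex D(6)] by blast
    then have "\<not> C \<inter> ?R \<subseteq> U0" using L unfolding R by (meson order_trans)
    then have "C \<inter> U \<noteq> {}" using avoid[OF fU(1)] by auto
    moreover have "C \<inter> X frontier_of U = {}"
      using avoid[OF fU(1)] D(4)[OF U] by (simp add: frontier_of_def interior_of_openin)
    ultimately have "C - U = {}" using connectedin_Int_frontier_of[OF C] by blast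
    moreover have "U \<subseteq> X closure_of U" using D(4)[OF U] by (simp add: closure_of_subset openin_subset)
    ultimately have CU: "C \<subseteq> X closure_of U" by blast
    \<comment> \<open>Points over \<open>U\<close> but outside \<open>Q\<close> form a closed set
      without ends, because the fibre of \<open>U\<close> lies in \<open>Q\<close>; its trace on
      \<open>X\<close> is therefore bounded.\<close>
    let ?F = "{\<xi> \<in> topspace (freudenthal X). \<xi> (U0, \<U>) = X closure_of U} - Q"
    have "closedin (freudenthal X) ?F"
      by (rule closedin_diff[OF closedin_component_fibre[OF f U] Q(1)])
    moreover have "?F \<inter> ends X = {}" using fU(3) unfolding eq end_fibre_def by blast
    ultimately have "bounded_in X {x \<in> topspace X. freudenthal_embed X x \<in> ?F}"
      by (rule bounded_in_if_closed_avoids_ends)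
    then obtain V where V: "V \<in> \<W>" "{x \<in> topspace X. freudenthal_embed X x \<in> ?F} \<subseteq> V"
      using Lindelof_exhaustion_bounded_in[OF ex] by blast
    have "freudenthal_embed X x \<in> ?F" if x: "x \<in> C" "freudenthal_embed X x \<notin> Q" for x
    proof -
      have "X closure_of U \<in> freudenthal_partition X (U0, \<U>)" unfolding freudenthal_partition_pair using U by blast
      then have "freudenthal_embed X x (U0, \<U>) = X closure_of U"
        unfolding freudenthal_embed_component[OF f]
        using block_of_unique[OF partition_on_freudenthal_partition[OF f]] subsetD[OF CU x(1)] by blast
      then show ?thesis using x(2) freudenthal_embed_in_topspace[OF subsetD[OF CX x(1)]] by blast
    qed
    then have "{x \<in> C. freudenthal_embed X x \<notin> Q} \<subseteq> V" using V(2) CX by blast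
    then show ?thesis using V(1) by blast
  qed
  have "\<exists>W\<in>\<W>. (\<Union>Q\<in>\<S>. {x \<in> C. freudenthal_embed X x \<notin> Q}) \<subseteq> W"
    by (rule Lindelof_exhaustion_countable_Union[OF ex S(1) small])
  moreover have "C \<subseteq> (\<Union>Q\<in>\<S>. {x \<in> C. freudenthal_embed X x \<notin> Q})"
  proof
    fix x assume x: "x \<in> C"
    then have "freudenthal_embed X x \<notin> ends X" using CX unfolding ends_def by blast
    then have "freudenthal_embed X x \<notin> \<Inter>\<S>" using e S(3) by auto
    then show "x \<in> (\<Union>Q\<in>\<S>. {x \<in> C. freudenthal_embed X x \<notin> Q})" using x by blast
  qed
  ultimately show False using not by (meson order_trans)
qed

lemma Lindelof_exhaustion_stationary:
  assumes "connected_space X" "locally_connected_space X" "locally_second_countable X"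
    and ex: "Lindelof_exhaustion X \<W>"
    and "second_countable (end_space X)" and short: "\<forall>e\<in>ends X. short_end X e"
  shows "\<exists>W\<in>\<W>. topspace X \<subseteq> W"
proof (cases "topspace X = {}")
  case True
  have "\<exists>W\<in>\<W>. \<forall>C\<in>{}. X closure_of C \<subseteq> W" using ex unfolding Lindelof_exhaustion_def by blast
  then show ?thesis using True by blast
next
  case False
  then obtain a where a: "a \<in> topspace X" by blast
  obtain \<K> where K: "countable \<K>" and base: "end_base \<K>"
    using countable_end_base[OF assms(5)] by blast
  have opW: "openin X W" and LW: "Lindelof_space (subtopology X W)" if "W \<in> \<W>" for W
    using ex that unfolding Lindelof_exhaustion_def by blast+
  \<comment> \<open>The point \<open>a\<close> keeps \<open>W0\<close> nonempty, as the lemma on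
    components of the complement requires.\<close>
  define \<T> where "\<T> = insert {a} ((\<lambda>k. X closure_of (snd k) - snd k) ` \<K>)"
  have "\<exists>W\<in>\<W>. T \<subseteq> W" if T: "T \<in> \<T>" for T
  proof -
    consider "T = {a}" | f U where "(f, U) \<in> \<K>" "T = X closure_of U - U" using T unfolding \<T>_def by auto
    then have "compactin X T"
    proof cases
      case 1
      then show ?thesis using a by simp
    next
      case 2
      obtain U0 \<U> where "f = (U0, \<U>)" by (cases f)
      moreover have "f \<in> freudenthal_families X" "U \<in> snd f" using base 2(1) unfolding end_base_def by blast+
      ultimately show ?thesis using 2(2) freudenthal_familiesD(8)[of U0 \<U> X U] by simp
    qed
    then have "bounded_in X T" unfolding bounded_in_def by blast
    then show ?thesis by (rule Lindelof_exhaustion_bounded_in[OF ex])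
  qed
  moreover have "countable \<T>" unfolding \<T>_def using K by simp
  ultimately have "\<exists>W\<in>\<W>. (\<Union>T\<in>\<T>. T) \<subseteq> W"
    using Lindelof_exhaustion_countable_Union[OF ex, of \<T> "\<lambda>T. T"] by blast
  then obtain W0 where W0: "W0 \<in> \<W>" "a \<in> W0" and fr: "\<And>f U. (f, U) \<in> \<K> \<Longrightarrow> X closure_of U - U \<subseteq> W0"
    unfolding \<T>_def by fastforce
  \<comment> \<open>One member beyond the closure of \<open>W0\<close>: every component of the
    complement meets it, and the disjoint open traces on the second countable \<open>W1\<close> are
    countable in number.\<close>
  have "\<exists>W\<in>\<W>. \<forall>C\<in>{W0}. X closure_of C \<subseteq> W"
    using ex W0(1) unfolding Lindelof_exhaustion_def by (metis countable_empty countable_insert empty_subsetI insert_subset)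
  then obtain W1 where W1: "W1 \<in> \<W>" "X closure_of W0 \<subseteq> W1" by blast
  let ?S = "X closure_of W0"
  have W0S: "W0 \<subseteq> ?S" using opW[OF W0(1)] by (simp add: closure_of_subset openin_subset)
  define \<C> where "\<C> = connected_components_of (subtopology X (topspace X - ?S))"
  have opC: "openin X C" if "C \<in> \<C>" for C
    using assms(2) that unfolding locally_connected_space_open_connected_components \<C>_def
    by (meson closedin_closure_of openin_diff openin_topspace)
  have CS: "C \<inter> ?S = {}" if "C \<in> \<C>" for C
    using connected_components_of_subset[of C "subtopology X (topspace X - ?S)"] that unfolding \<C>_def by auto
  have meet: "C \<inter> W1 \<noteq> {}" if "C \<in> \<C>" for C
    using connected_components_of_complement_meet[OF assms(1,2) closedin_closure_of opW[OF W1(1)] W1(2)]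
      W0(2) W0S that unfolding \<C>_def by blast
  have disj: "C \<inter> D = {}" if "C \<in> \<C>" "D \<in> \<C>" "C \<noteq> D" for C D
    using that pairwise_disjoint_connected_components_of[of "subtopology X (topspace X - ?S)"]
    unfolding \<C>_def pairwise_def disjnt_def by blast
  have "countable ((\<lambda>C. C \<inter> W1) ` \<C>)"
  proof (rule second_countable_imp_countable_disjoint)
    show "second_countable (subtopology X W1)"
      by (rule Lindelof_imp_second_countable[OF assms(3) openin_subset[OF opW[OF W1(1)]] LW[OF W1(1)]])
    show "pairwise disjnt ((\<lambda>C. C \<inter> W1) ` \<C>)"
    proof (rule pairwiseI)
      fix A B assume "A \<in> (\<lambda>C. C \<inter> W1) ` \<C>" "B \<in> (\<lambda>C. C \<inter> W1) ` \<C>" "A \<noteq> B"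
      then obtain C D where "C \<in> \<C>" "D \<in> \<C>" "C \<noteq> D" "A = C \<inter> W1" "B = D \<inter> W1" by blast
      then show "disjnt A B" using disj[of C D] unfolding disjnt_def by blast
    qed
    show "openin (subtopology X W1) A" if A: "A \<in> (\<lambda>C. C \<inter> W1) ` \<C>" for A
      using A opC openin_subtopology_Int by blast
    show "{} \<notin> (\<lambda>C. C \<inter> W1) ` \<C>" using meet by fastforce
  qed
  moreover have "inj_on (\<lambda>C. C \<inter> W1) \<C>"
  proof (rule inj_onI, rule ccontr)
    fix C D assume CD: "C \<in> \<C>" "D \<in> \<C>" "C \<inter> W1 = D \<inter> W1" "C \<noteq> D"
    then show False using disj[OF CD(1,2,4)] meet[OF CD(1)] by blast
  qed
  ultimately have countC: "countable \<C>" by (simp add: countable_image_inj_eq)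
  have "\<exists>W\<in>\<W>. C \<subseteq> W" if C: "C \<in> \<C>" for C
  proof (rule connected_avoiding_frontiers_small[OF ex short base])
    have "connectedin (subtopology X (topspace X - ?S)) C"
      using C unfolding \<C>_def by (rule connectedin_connected_components_of)
    then show "connectedin X C" by (simp add: connectedin_subtopology)
    show "C \<inter> (X closure_of U - U) = {}" if k: "(f, U) \<in> \<K>" for f U
      using fr[OF k] CS[OF C] W0S by blast
  qed
  then have "\<exists>W\<in>\<W>. C \<subseteq> W" if "C \<in> insert W1 \<C>" for C using that W1(1) by blast
  then have "\<exists>W\<in>\<W>. (\<Union>C\<in>insert W1 \<C>. C) \<subseteq> W"
    using Lindelof_exhaustion_countable_Union[OF ex, of "insert W1 \<C>" "\<lambda>C. C"] countC by blast
  moreover have "topspace X \<subseteq> (\<Union>C\<in>insert W1 \<C>. C)"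
  proof
    fix x assume x: "x \<in> topspace X"
    show "x \<in> (\<Union>C\<in>insert W1 \<C>. C)"
    proof (cases "x \<in> ?S")
      case False
      then have "x \<in> \<Union>\<C>"
        unfolding \<C>_def Union_connected_components_of using x by simp
      then show ?thesis by blast
    qed (use W1(2) in blast)
  qed
  ultimately show ?thesis by (meson order_trans)
qed

end

lemma second_countable_if_Lindelof_exhaustion_stationary:
  assumes "locally_second_countable X" "Lindelof_exhaustion X \<W>" "\<exists>W\<in>\<W>. topspace X \<subseteq> W"
  shows "second_countable X"
proof -
  obtain W where W: "W \<in> \<W>" "topspace X \<subseteq> W" using assms(3) by blast
  have "Lindelof_space (subtopology X W)" "W \<subseteq> topspace X"
    using W(1) assms(2) unfolding Lindelof_exhaustion_def by auto
  then show ?thesis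
    using Lindelof_imp_second_countable[OF assms(1), of W] W(2) by (simp add: subset_antisym)
qed

theorem theorem1p3:
  fixes M :: "'a topology"
  assumes "topological_manifold M" and "type_I M"
  shows "metrizable_space M \<longleftrightarrow>
           second_countable (end_space M) \<and> (\<forall>e\<in>ends M. short_end M e)"
proof -
  have Hausdorff: "Hausdorff_space M" and connected: "connected_space M"
    using assms(1) unfolding topological_manifold_def by blast+
  interpret locally_compact_Hausdorff M
    using Hausdorff topological_manifold_imp_locally_compact_space[OF assms(1)] by unfold_locales
  have regular: "regular_space M"
    using Hausdorff locally_compact locally_compact_Hausdorff_imp_regular_space by blast
  note lsc = topological_manifold_imp_locally_second_countable[OF assms(1)]
  obtain \<W> where ex: "Lindelof_exhaustion M \<W>" by (rule type_I_Lindelof_exhaustion[OF assms(2)])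
  show ?thesis
  proof
    assume "metrizable_space M"
    then have sc: "second_countable M"
      using second_countable_if_Lindelof_exhaustion_stationary[OF lsc ex]
        metrizable_connected_Lindelof_exhaustion[OF _ connected lsc ex] by blast
    have "second_countable (end_space M)"
      by (rule second_countable_end_space[OF sc connected])
    then show "second_countable (end_space M) \<and> (\<forall>e\<in>ends M. short_end M e)"
      using short_end_if_second_countable[OF sc] by blast
  next
    assume "second_countable (end_space M) \<and> (\<forall>e\<in>ends M. short_end M e)"
    then have "\<exists>W\<in>\<W>. topspace M \<subseteq> W"
      using Lindelof_exhaustion_stationary[OF connected
          topological_manifold_imp_locally_connected_space[OF assms(1)] lsc ex] by blast
    then show "metrizable_space M"
      using second_countable_imp_metrizable_space[OF regular Hausdorff]
        second_countable_if_Lindelof_exhaustion_stationary[OF lsc ex] by blast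
  qed
qed

end
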